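(* Let $Q \in \mathbb{R}^{m \times n}$, $C \in \mathbb{R}^{m \times p}$ and $D \in \mathbb{R}^{p \times n}$ be matrices such that $Q = CD$ is a $k$-sparse factorization of $Q$. Consider iterations of the form $$x_{t+1} = x_t - \frac{x_t^T q_i}{q_i^T q_i}\, q_i$$ (where the index $i=i(t)$ may depend on $t$) that start from an arbitrary vector $x_0 \in \mathbb{R}^m$. If every $q_i$ used in these iterations is a column of $Q$, then the computational complexity of running $N$ such iterations (that is, of computing the vector $x_N$) is $$\mathcal{O}\big(Nk + (m+n)k^2\big).$$ With the same complexity, one can compute a vector $y_N\in\mathbb{R}^n$ such that $x_N = x_0 + Q y_N$, where $x_N$ denotes the vector resulting from the first $N$ iterations.
   Context: The support of a vector is the set of indices of its nonzero entries; a vector is $k$-sparse if its support has at most $k$ elements. Let $Q = CD$ with $C\in\mathbb{R}^{m\times p}$ having columns $c_1,\dots,c_p$ and $D\in\mathbb{R}^{p\times n}$ having columns $d_1,\dots,d_n$. The forward-overlap $FO(c_i)$ of a column $c_i$ is the list of columns $c_j$ with $j\ge i$ whose support overlaps (has nonempty intersection) with the support of $c_i$. The factorization $Q=CD$ is called $k$-sparse if $\left|\bigcup_{i\in \mathrm{supp}(d_j)} FO(c_i)\right|\le k$ for every $j$. By convention, each column of $C$ and each row of $D$ is nonzero. The factors $C$ and $D$ are given (stored as sparse matrices); complexity is counted in elementary scalar operations. The directions $q_i$ used in the iterations are nonzero. *)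

theory Defs
  imports "Jordan_Normal_Form.Matrix"
begin

section \<open>Sparse factorizations\<close>

definition supp :: "real vec \<Rightarrow> nat set" where
  "supp v = {i. i < dim_vec v \<and> v $ i \<noteq> 0}"

text \<open>The forward overlap is a list of columns, so it is represented by the set of their
  indices: equal columns at different positions are counted separately.\<close>

definition forward_overlap :: "real mat \<Rightarrow> nat \<Rightarrow> nat set" where
  "forward_overlap C i =
     {j. i \<le> j \<and> j < dim_col C \<and> supp (col C i) \<inter> supp (col C j) \<noteq> {}}"

text \<open>The standing convention that \<open>C\<close> has no zero column and \<open>D\<close> no zero row is included.\<close>

definition sparse_factorization :: "nat \<Rightarrow> real mat \<Rightarrow> real mat \<Rightarrow> real mat \<Rightarrow> bool" where
  "sparse_factorization k Q C D \<longleftrightarrow>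
     dim_col C = dim_row D \<and> Q = C * D \<and>
     (\<forall>i < dim_col C. col C i \<noteq> 0\<^sub>v (dim_row C)) \<and>
     (\<forall>i < dim_row D. row D i \<noteq> 0\<^sub>v (dim_col D)) \<and>
     (\<forall>j < dim_col D. card (\<Union>i \<in> supp (col D j). forward_overlap C i) \<le> k)"

section \<open>The iteration\<close>

primrec iterate :: "(nat \<Rightarrow> real vec) \<Rightarrow> real vec \<Rightarrow> nat \<Rightarrow> real vec" where
  "iterate q x0 0 = x0"
| "iterate q x0 (Suc t) =
     iterate q x0 t - ((iterate q x0 t \<bullet> q t) / (q t \<bullet> q t)) \<cdot>\<^sub>v q t"

section \<open>Computational model\<close>

text \<open>
  Complexity is measured for a random access machine with unit cost, which has separate memories
  for natural numbers (indices) and real numbers. Both memories consist of named two-dimensional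
  arrays; vectors and scalars are arrays that are only used at second index \<open>0\<close> or at index
  \<open>(0,0)\<close>. Each memory access, arithmetic operation, constant, comparison, assignment and loop step
  costs one unit, on indices as well as on real numbers. A program is a finite piece of syntax; it
  is independent of the input and of its dimensions. Index arithmetic is restricted to addition
  and subtraction, so that large amounts of data cannot be packed into one index.

  The only loops are \<open>For v b c\<close>, which evaluates the bound \<open>b\<close> once and runs \<open>c\<close> with the
  index variable \<open>v\<close> set to \<open>0, \<dots>, b - 1\<close>. Thus every program terminates. Since such programs
  can be run on an ordinary real random access machine with constant overhead per step, upper
  bounds in this model are upper bounds for the latter as well.
\<close>

record memory =
  imem :: "string \<Rightarrow> nat \<Rightarrow> nat \<Rightarrow> nat"
  rmem :: "string \<Rightarrow> nat \<Rightarrow> nat \<Rightarrow> real"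

datatype iexp =
    INum nat
  | IGet string iexp iexp
  | IAdd iexp iexp
  | ISub iexp iexp

datatype rexp =
    RNum int
  | RGet string iexp iexp
  | RAdd rexp rexp
  | RSub rexp rexp
  | RMul rexp rexp
  | RDiv rexp rexp

datatype test = ILess iexp iexp | RLess rexp rexp

datatype com =
    Skip
  | ISet string iexp iexp iexp
  | RSet string iexp iexp rexp
  | Seq com com
  | Cond test com com
  | For string iexp com

primrec ival :: "iexp \<Rightarrow> memory \<Rightarrow> nat" where
  "ival (INum n) s = n"
| "ival (IGet a e f) s = imem s a (ival e s) (ival f s)"
| "ival (IAdd e f) s = ival e s + ival f s"
| "ival (ISub e f) s = ival e s - ival f s"

primrec icost :: "iexp \<Rightarrow> nat" where
  "icost (INum n) = 1"
| "icost (IGet a e f) = icost e + icost f + 1"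
| "icost (IAdd e f) = icost e + icost f + 1"
| "icost (ISub e f) = icost e + icost f + 1"

primrec rval :: "rexp \<Rightarrow> memory \<Rightarrow> real" where
  "rval (RNum z) s = of_int z"
| "rval (RGet a e f) s = rmem s a (ival e s) (ival f s)"
| "rval (RAdd u v) s = rval u s + rval v s"
| "rval (RSub u v) s = rval u s - rval v s"
| "rval (RMul u v) s = rval u s * rval v s"
| "rval (RDiv u v) s = rval u s / rval v s"

primrec rcost :: "rexp \<Rightarrow> nat" where
  "rcost (RNum z) = 1"
| "rcost (RGet a e f) = icost e + icost f + 1"
| "rcost (RAdd u v) = rcost u + rcost v + 1"
| "rcost (RSub u v) = rcost u + rcost v + 1"
| "rcost (RMul u v) = rcost u + rcost v + 1"
| "rcost (RDiv u v) = rcost u + rcost v + 1"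

primrec tval :: "test \<Rightarrow> memory \<Rightarrow> bool" where
  "tval (ILess e f) s \<longleftrightarrow> ival e s < ival f s"
| "tval (RLess u v) s \<longleftrightarrow> rval u s < rval v s"

primrec tcost :: "test \<Rightarrow> nat" where
  "tcost (ILess e f) = icost e + icost f + 1"
| "tcost (RLess u v) = rcost u + rcost v + 1"

definition array_upd :: "(string \<Rightarrow> nat \<Rightarrow> nat \<Rightarrow> 'a) \<Rightarrow> string \<Rightarrow> nat \<Rightarrow> nat \<Rightarrow> 'a
    \<Rightarrow> string \<Rightarrow> nat \<Rightarrow> nat \<Rightarrow> 'a" where
  "array_upd h a i j x = h(a := (h a)(i := (h a i)(j := x)))"

definition iset :: "string \<Rightarrow> nat \<Rightarrow> nat \<Rightarrow> nat \<Rightarrow> memory \<Rightarrow> memory" where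
  "iset a i j x s = s\<lparr>imem := array_upd (imem s) a i j x\<rparr>"

definition rset :: "string \<Rightarrow> nat \<Rightarrow> nat \<Rightarrow> real \<Rightarrow> memory \<Rightarrow> memory" where
  "rset a i j x s = s\<lparr>rmem := array_upd (rmem s) a i j x\<rparr>"

primrec for_loop :: "(nat \<Rightarrow> 'a \<Rightarrow> 'a) \<Rightarrow> nat \<Rightarrow> 'a \<Rightarrow> 'a" where
  "for_loop f 0 s = s"
| "for_loop f (Suc l) s = f l (for_loop f l s)"

primrec run :: "com \<Rightarrow> memory \<Rightarrow> memory" where
  "run Skip s = s"
| "run (ISet a e f g) s = iset a (ival e s) (ival f s) (ival g s) s"
| "run (RSet a e f u) s = rset a (ival e s) (ival f s) (rval u s) s"
| "run (Seq c d) s = run d (run c s)"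
| "run (Cond b c d) s = (if tval b s then run c s else run d s)"
| "run (For v b c) s = for_loop (\<lambda>l s'. run c (iset v 0 0 l s')) (ival b s) s"

text \<open>Step \<open>l\<close> of a loop is charged with the cost of its body in the memory that results from the
  steps before \<open>l\<close>.\<close>

primrec cost :: "com \<Rightarrow> memory \<Rightarrow> nat" where
  "cost Skip s = 1"
| "cost (ISet a e f g) s = icost e + icost f + icost g + 1"
| "cost (RSet a e f u) s = icost e + icost f + rcost u + 1"
| "cost (Seq c d) s = cost c s + cost d (run c s)"
| "cost (Cond b c d) s = tcost b + (if tval b s then cost c s else cost d s)"
| "cost (For v b c) s = icost b + 1 +
     (\<Sum>l < ival b s. 1 + cost c (iset v 0 0 l
        (for_loop (\<lambda>l' s'. run c (iset v 0 0 l' s')) l s)))"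

section \<open>Input\<close>

text \<open>Sparse storage by columns: column \<open>j\<close> of \<open>A\<close> is stored as a list of \<open>len j\<close> pairs of a row
  index and a value, one for each nonzero entry, in arbitrary order.\<close>

definition sparse_columns ::
  "(nat \<Rightarrow> nat) \<Rightarrow> (nat \<Rightarrow> nat \<Rightarrow> nat) \<Rightarrow> (nat \<Rightarrow> nat \<Rightarrow> real) \<Rightarrow> real mat \<Rightarrow> bool" where
  "sparse_columns len idx val A \<longleftrightarrow>
     (\<forall>j < dim_col A. bij_betw (idx j) {..<len j} (supp (col A j)) \<and>
        (\<forall>l < len j. val j l = col A j $ idx j l))"

text \<open>The initial memory contains the dimensions, the two factors, the initial vector, the number
  of iterations and the indices of the columns of \<open>Q\<close> to be used. It contains neither \<open>Q\<close> nor
  the sparsity parameter. As usual for random access machines, the remaining memory is zero.\<close>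

definition initial_memory ::
  "memory \<Rightarrow> real mat \<Rightarrow> real mat \<Rightarrow> real vec \<Rightarrow> nat \<Rightarrow> (nat \<Rightarrow> nat) \<Rightarrow> bool" where
  "initial_memory s C D x0 N i \<longleftrightarrow>
     imem s ''m'' 0 0 = dim_row C \<and>
     imem s ''p'' 0 0 = dim_col C \<and>
     imem s ''n'' 0 0 = dim_col D \<and>
     imem s ''N'' 0 0 = N \<and>
     (\<forall>t < N. imem s ''i'' t 0 = i t) \<and>
     (\<forall>r < dim_vec x0. rmem s ''x0'' r 0 = x0 $ r) \<and>
     sparse_columns (\<lambda>j. imem s ''C_len'' j 0) (imem s ''C_idx'') (rmem s ''C_val'') C \<and>
     sparse_columns (\<lambda>j. imem s ''D_len'' j 0) (imem s ''D_idx'') (rmem s ''D_val'') D \<and>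
     (\<forall>a. a \<notin> {''m'', ''p'', ''n'', ''N'', ''i'', ''C_len'', ''C_idx'', ''D_len'', ''D_idx''} \<longrightarrow>
        imem s a = (\<lambda>_ _. 0)) \<and>
     (\<forall>a. a \<notin> {''x0'', ''C_val'', ''D_val''} \<longrightarrow> rmem s a = (\<lambda>_ _. 0))"

definition stored_vec :: "memory \<Rightarrow> string \<Rightarrow> nat \<Rightarrow> real vec" where
  "stored_vec s a d = vec d (\<lambda>r. rmem s a r 0)"

end

theory Submission
  imports Defs
begin

text \<open>
  Write \<open>C\<^sup>T C = W + W\<^sup>T\<close> with \<open>W\<close> upper triangular; row \<open>i\<close> of \<open>W\<close> is supported on the forward
  overlap of \<open>c\<^sub>i\<close>. Hence \<open>u\<^sub>j = W\<^sup>T d\<^sub>j\<close> has at most \<open>k\<close> nonzero entries. The iterates are kept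
  implicitly as \<open>x = x\<^sub>0 + C z\<close> with \<open>z = D y\<close>, together with \<open>v = C\<^sup>T x\<^sub>0 + W\<^sup>T z\<close>. Then
  \<open>x \<bullet> q\<^sub>j = v \<bullet> d\<^sub>j + z \<bullet> u\<^sub>j\<close> and \<open>q\<^sub>j \<bullet> q\<^sub>j = 2 (u\<^sub>j \<bullet> d\<^sub>j)\<close>, and one iteration subtracts a
  multiple of \<open>d\<^sub>j\<close> from \<open>z\<close>, the same multiple of \<open>u\<^sub>j\<close> from \<open>v\<close> and a number from \<open>y\<^sub>j\<close>. All this
  takes \<open>O(k)\<close> steps.

  The columns of \<open>C\<close> that meet a given row all lie in the forward overlap of the first of them, so
  every row of \<open>C\<close> has at most \<open>k\<close> nonzero entries. Running through the pairs of entries in each row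
  yields \<open>W\<close> in \<open>O(m k\<^sup>2)\<close> steps, and then the vectors \<open>u\<^sub>j\<close> are obtained in \<open>O(n k\<^sup>2)\<close> steps. As \<open>D\<close>
  has no zero row, \<open>p \<le> n k\<close>.
\<close>

section \<open>Programs and their costs\<close>

primrec iwrites :: "com \<Rightarrow> string set" where
  "iwrites Skip = {}"
| "iwrites (ISet a e f g) = {a}"
| "iwrites (RSet a e f u) = {}"
| "iwrites (Seq c d) = iwrites c \<union> iwrites d"
| "iwrites (Cond b c d) = iwrites c \<union> iwrites d"
| "iwrites (For v b c) = insert v (iwrites c)"

primrec rwrites :: "com \<Rightarrow> string set" where
  "rwrites Skip = {}"
| "rwrites (ISet a e f g) = {}"
| "rwrites (RSet a e f u) = {a}"
| "rwrites (Seq c d) = rwrites c \<union> rwrites d"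
| "rwrites (Cond b c d) = rwrites c \<union> rwrites d"
| "rwrites (For v b c) = rwrites c"

definition unchanged :: "string set \<Rightarrow> string set \<Rightarrow> memory \<Rightarrow> memory \<Rightarrow> bool" where
  "unchanged I R s t \<longleftrightarrow>
     (\<forall>a. a \<notin> I \<longrightarrow> imem t a = imem s a) \<and> (\<forall>a. a \<notin> R \<longrightarrow> rmem t a = rmem s a)"

lemma imem_iset [simp]:
  "imem (iset a i j x s) b = (if b = a then (imem s a)(i := (imem s a i)(j := x)) else imem s b)"
  by (simp add: iset_def array_upd_def)

lemma rmem_iset [simp]: "rmem (iset a i j x s) = rmem s"
  by (simp add: iset_def)

lemma rmem_rset [simp]:
  "rmem (rset a i j x s) b = (if b = a then (rmem s a)(i := (rmem s a i)(j := x)) else rmem s b)"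
  by (simp add: rset_def array_upd_def)

lemma imem_rset [simp]: "imem (rset a i j x s) = imem s"
  by (simp add: rset_def)

lemma unchanged_for_loop:
  assumes "\<And>l s. unchanged I R s (f l s)"
  shows "unchanged I R s (for_loop f n s)"
  using assms by (induction n) (auto simp: unchanged_def)

text \<open>Induction on the program; a loop writes its index variable besides the arrays of its
  body. As the write sets are syntactic, the preservation of an array never has to be carried
  through an invariant.\<close>

lemma unchanged_run: "unchanged (iwrites c) (rwrites c) s (run c s)"
proof (induction c arbitrary: s)
  case (For v b c)
  have "unchanged (insert v (iwrites c)) (rwrites c) s (run c (iset v 0 0 l s))" for l s
    using For[of "iset v 0 0 l s"] by (auto simp: unchanged_def)
  then show ?case
    by (auto intro: unchanged_for_loop)
qed (auto simp: unchanged_def)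

text \<open>Correctness and cost are proved together, since the cost of a step depends on the memory
  in which it starts. The step premise supplies the frame condition relative to \<open>s\<close>, so
  \<open>I\<close> only has to describe the arrays that the loop changes. The bound
  \<open>T l\<close> may vary with the step, which is needed for columns of different
  lengths.\<close>

lemma run_For:
  assumes bound: "ival b s = M" and "I 0 s"
    and "\<And>l t. \<lbrakk>l < M; unchanged (insert v (iwrites c)) (rwrites c) s t; I l t\<rbrakk> \<Longrightarrow>
      I (Suc l) (run c (iset v 0 0 l t)) \<and> cost c (iset v 0 0 l t) \<le> T l"
    and total: "icost b + 1 + (\<Sum>l < M. 1 + T l) \<le> X"
  shows "I M (run (For v b c) s) \<and> cost (For v b c) s \<le> X"
proof -
  let ?t = "\<lambda>l. for_loop (\<lambda>l' s'. run c (iset v 0 0 l' s')) l s"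
  have *: "I l (?t l)" if "l \<le> M" for l
    using that
  proof (induction l)
    case (Suc l)
    \<comment> \<open>The memory before step \<open>l\<close> is the result of the loop with the
      constant bound \<open>l\<close>, so the frame property of programs applies to it.\<close>
    then show ?case
      using assms(3)[of l "?t l"] unchanged_run[of "For v (INum l) c" s] by simp
  qed (simp add: assms(2))
  have "cost c (iset v 0 0 l (?t l)) \<le> T l" if "l < M" for l
    using assms(3)[of l "?t l"] unchanged_run[of "For v (INum l) c" s] * that by simp
  then have "cost (For v b c) s \<le> icost b + 1 + (\<Sum>l < M. 1 + T l)"
    by (auto intro!: sum_mono simp: bound)
  then show ?thesis
    using *[of M] total by (simp add: bound)
qed

section \<open>Sparse matrices built by accumulation, and loops that accumulate\<close>

abbreviation ivar :: "string \<Rightarrow> iexp" where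
  "ivar a \<equiv> IGet a (INum 0) (INum 0)"

abbreviation rvar :: "string \<Rightarrow> rexp" where
  "rvar a \<equiv> RGet a (INum 0) (INum 0)"

definition radd :: "string \<Rightarrow> iexp \<Rightarrow> iexp \<Rightarrow> rexp \<Rightarrow> com" where
  "radd a e f u = RSet a e f (RAdd (RGet a e f) u)"

lemma rwrites_radd [simp]: "rwrites (radd a e f u) = {a}" "iwrites (radd a e f u) = {}"
  by (simp_all add: radd_def)

text \<open>The matrix entry \<open>(i, j)\<close> is stored at \<open>A[i, j]\<close>. Row \<open>i\<close> has a duplicate-free list of
  column indices \<open>L[i, 0], L[i, 1], \<dots>\<close> of length \<open>B[i, 0]\<close>, and \<open>M\<close> marks the listed positions.\<close>

definition sparse_rows :: "string \<Rightarrow> string \<Rightarrow> string \<Rightarrow> string \<Rightarrow> memory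
    \<Rightarrow> (nat \<Rightarrow> nat \<Rightarrow> real) \<Rightarrow> (nat \<Rightarrow> nat set) \<Rightarrow> bool" where
  "sparse_rows A L M B s V S \<longleftrightarrow>
     rmem s A = V \<and>
     (\<forall>i. bij_betw (imem s L i) {..<imem s B i 0} (S i)) \<and>
     (\<forall>i j. imem s M i j = (if j \<in> S i then 1 else 0))"

text \<open>The mark decides in constant time whether the position is already listed, so the lists
  stay free of duplicates without a search. A position is listed once it is visited, even if its
  value is zero or cancels later.\<close>

definition accum :: "string \<Rightarrow> string \<Rightarrow> string \<Rightarrow> string \<Rightarrow> string \<Rightarrow> string \<Rightarrow> rexp \<Rightarrow> com" where
  "accum A L M B a b e =
     Seq (radd A (ivar a) (ivar b) e)
       (Cond (ILess (IGet M (ivar a) (ivar b)) (INum 1))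
         (Seq (ISet L (ivar a) (IGet B (ivar a) (INum 0)) (ivar b))
           (Seq (ISet B (ivar a) (INum 0) (IAdd (IGet B (ivar a) (INum 0)) (INum 1)))
             (ISet M (ivar a) (ivar b) (INum 1))))
         Skip)"

lemma writes_accum [simp]:
  "iwrites (accum A L M B a b e) = {L, B, M}" "rwrites (accum A L M B a b e) = {A}"
  by (auto simp: accum_def)

lemma sparse_rows_iset [simp]:
  "a \<notin> {L, M, B} \<Longrightarrow> sparse_rows A L M B (iset a i j x s) V S = sparse_rows A L M B s V S"
  by (auto simp: sparse_rows_def)

lemma sparse_rows_unchanged:
  assumes "sparse_rows A L M B s V S" "unchanged I R s t" "I \<inter> {L, M, B} = {}" "A \<notin> R"
  shows "sparse_rows A L M B t V S"
  using assms by (auto simp: sparse_rows_def unchanged_def)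

lemma bij_betw_append:
  assumes "bij_betw f {..<n} S" "x \<notin> S"
  shows "bij_betw (f(n := x)) {..<Suc n} (insert x S)"
proof -
  have "bij_betw (f(n := x)) {..<n} S"
    using assms(1) by (rule bij_betw_cong[THEN iffD1, rotated]) simp
  then show ?thesis
    using notIn_Un_bij_betw[of n "{..<n}" "f(n := x)" S] assms(2) by (simp add: lessThan_Suc)
qed

text \<open>The longer branch takes 56 units besides the evaluation of \<open>e\<close>. Only names
  of index arrays have to be distinct: \<open>A\<close> lives in the other memory and may coincide
  with \<open>L\<close>, as it does in all uses.\<close>

lemma run_accum:
  assumes "distinct [L, M, B, a, b]" and rows: "sparse_rows A L M B s V S"
    and s: "imem s a 0 0 = i0" "imem s b 0 0 = j0" "rval e s = w" and "rcost e + 60 \<le> X"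
  shows "sparse_rows A L M B (run (accum A L M B a b e) s)
      (\<lambda>i j. V i j + (if i = i0 \<and> j = j0 then w else 0))
      (\<lambda>i. S i \<union> (if i = i0 then {j0} else {})) \<and>
    cost (accum A L M B a b e) s \<le> X"
proof
  have V: "rmem s A = V" and L: "bij_betw (imem s L i) {..<imem s B i 0} (S i)"
    and M: "imem s M i j = (if j \<in> S i then 1 else 0)" for i j
    using rows by (auto simp: sparse_rows_def)
  show "sparse_rows A L M B (run (accum A L M B a b e) s)
      (\<lambda>i j. V i j + (if i = i0 \<and> j = j0 then w else 0))
      (\<lambda>i. S i \<union> (if i = i0 then {j0} else {}))"
  proof (cases "j0 \<in> S i0")
    case True
    then have S: "(\<lambda>i. S i \<union> (if i = i0 then {j0} else {})) = S"
      by (auto simp: fun_eq_iff)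
    have run: "run (accum A L M B a b e) s = rset A i0 j0 (V i0 j0 + w) s"
      using True by (simp add: accum_def radd_def M V s)
    show ?thesis
      unfolding run S using L M by (simp add: sparse_rows_def V fun_eq_iff)
  next
    case False
    have ne: "a \<noteq> L" "a \<noteq> M" "a \<noteq> B" "b \<noteq> L" "b \<noteq> M" "b \<noteq> B"
        "L \<noteq> M" "L \<noteq> B" "B \<noteq> L" "M \<noteq> L" "M \<noteq> B" "B \<noteq> M"
      using assms(1) by auto
    have run: "run (accum A L M B a b e) s = iset M i0 j0 1 (iset B i0 0 (imem s B i0 0 + 1)
        (iset L i0 (imem s B i0 0) j0 (rset A i0 j0 (V i0 j0 + w) s)))"
      using False by (simp add: accum_def radd_def M V ne s)
    have "bij_betw (imem (run (accum A L M B a b e) s) L i)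
        {..<imem (run (accum A L M B a b e) s) B i 0} (S i \<union> (if i = i0 then {j0} else {}))" for i
      using L bij_betw_append[OF L False] by (simp add: run ne)
    moreover have "imem (run (accum A L M B a b e) s) M i j =
        (if j \<in> S i \<union> (if i = i0 then {j0} else {}) then 1 else 0)" for i j
      by (simp add: run M ne)
    moreover have "rmem (run (accum A L M B a b e) s) A =
        (\<lambda>i j. V i j + (if i = i0 \<and> j = j0 then w else 0))"
      by (simp add: run V fun_eq_iff)
    ultimately show ?thesis
      by (simp add: sparse_rows_def)
  qed
  show "cost (accum A L M B a b e) s \<le> X"
    using assms(6) by (simp add: accum_def radd_def)
qed

text \<open>The effect of a step is assumed to be additive whatever \<open>V\<close> and
  \<open>S\<close> were before. Such effects compose to a sum and a union, and the conclusion again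
  has the form of the premise, so nested loops are handled by nesting this rule.\<close>

lemma run_For_accum:
  assumes "ival b s = M" and "sparse_rows A L K B s V S"
    and "\<And>l t V S. \<lbrakk>l < M; unchanged (insert v (iwrites c)) (rwrites c) s t;
      sparse_rows A L K B t V S\<rbrakk> \<Longrightarrow>
      sparse_rows A L K B (run c (iset v 0 0 l t)) (\<lambda>i j. V i j + f l i j) (\<lambda>i. S i \<union> F l i) \<and>
      cost c (iset v 0 0 l t) \<le> T l"
    and "icost b + 1 + (\<Sum>l < M. 1 + T l) \<le> X"
  shows "sparse_rows A L K B (run (For v b c) s)
      (\<lambda>i j. V i j + (\<Sum>l < M. f l i j)) (\<lambda>i. S i \<union> (\<Union>l < M. F l i)) \<and>
    cost (For v b c) s \<le> X"
proof (rule run_For[where M = M and T = T and I = "\<lambda>k t. sparse_rows A L K B t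
    (\<lambda>i j. V i j + (\<Sum>l < k. f l i j)) (\<lambda>i. S i \<union> (\<Union>l < k. F l i))"])
  show "sparse_rows A L K B s (\<lambda>i j. V i j + (\<Sum>l<0. f l i j)) (\<lambda>i. S i \<union> (\<Union>l<0. F l i))"
    using assms(2) by simp
next
  fix l t
  assume *: "l < M" "unchanged (insert v (iwrites c)) (rwrites c) s t"
    "sparse_rows A L K B t (\<lambda>i j. V i j + (\<Sum>l < l. f l i j)) (\<lambda>i. S i \<union> (\<Union>l < l. F l i))"
  show "sparse_rows A L K B (run c (iset v 0 0 l t)) (\<lambda>i j. V i j + (\<Sum>l<Suc l. f l i j))
      (\<lambda>i. S i \<union> (\<Union>l<Suc l. F l i)) \<and> cost c (iset v 0 0 l t) \<le> T l"
    using assms(3)[OF *] by (simp add: lessThan_Suc Un_ac add_ac)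
qed (use assms in simp_all)

lemma run_For_add:
  assumes "ival b s = M"
    and "\<And>l t. \<lbrakk>l < M; unchanged (insert v (iwrites c)) (rwrites c) s t\<rbrakk> \<Longrightarrow>
      rmem (run c (iset v 0 0 l t)) A = (\<lambda>i j. rmem t A i j + f l i j) \<and>
      cost c (iset v 0 0 l t) \<le> T l"
    and "icost b + 1 + (\<Sum>l < M. 1 + T l) \<le> X"
  shows "rmem (run (For v b c) s) A = (\<lambda>i j. rmem s A i j + (\<Sum>l < M. f l i j)) \<and>
    cost (For v b c) s \<le> X"
proof (rule run_For[where M = M and T = T and
    I = "\<lambda>k t. rmem t A = (\<lambda>i j. rmem s A i j + (\<Sum>l < k. f l i j))"])
  fix l t
  assume *: "l < M" "unchanged (insert v (iwrites c)) (rwrites c) s t"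
    "rmem t A = (\<lambda>i j. rmem s A i j + (\<Sum>l < l. f l i j))"
  show "rmem (run c (iset v 0 0 l t)) A = (\<lambda>i j. rmem s A i j + (\<Sum>l<Suc l. f l i j)) \<and>
      cost c (iset v 0 0 l t) \<le> T l"
    using assms(2)[OF *(1,2)] *(3) by (simp add: add_ac)
qed (use assms in simp_all)

text \<open>A list without repetitions is a bijection from its positions to \<open>Z\<close>. Hence
  the order of the list is irrelevant: the sum over positions is the sum over \<open>Z\<close>, and
  the number of steps is \<open>card Z\<close>.\<close>

lemma run_For_accum_list:
  assumes "ival b s = M" and "sparse_rows A L K B s V S" and e: "bij_betw e {..<M} Z"
    and "\<And>l t V S. \<lbrakk>l < M; e l \<in> Z; unchanged (insert v (iwrites c)) (rwrites c) s t;
      sparse_rows A L K B t V S\<rbrakk> \<Longrightarrow>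
      sparse_rows A L K B (run c (iset v 0 0 l t)) (\<lambda>i j. V i j + f (e l) i j) (\<lambda>i. S i \<union> F (e l) i) \<and>
      cost c (iset v 0 0 l t) \<le> T"
    and "card Z \<le> w" and "icost b + 1 + w * (1 + T) \<le> X"
  shows "sparse_rows A L K B (run (For v b c) s)
      (\<lambda>i j. V i j + (\<Sum>z\<in>Z. f z i j)) (\<lambda>i. S i \<union> (\<Union>z\<in>Z. F z i)) \<and>
    cost (For v b c) s \<le> X"
proof -
  have M: "M = card Z"
    using bij_betw_same_card[OF e] by simp
  have "sparse_rows A L K B (run (For v b c) s)
      (\<lambda>i j. V i j + (\<Sum>l<M. f (e l) i j)) (\<lambda>i. S i \<union> (\<Union>l<M. F (e l) i)) \<and>
    cost (For v b c) s \<le> icost b + 1 + M * (1 + T)"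
    using assms bij_betwE[OF e] by (intro run_For_accum[where T = "\<lambda>_. T"]) auto
  moreover have "M * (1 + T) \<le> w * (1 + T)"
    using assms(5) M by (intro mult_right_mono) auto
  moreover have "(\<Union>l<M. F (e l) i) = (\<Union>z\<in>Z. F z i)" for i
    using e by (auto simp: bij_betw_def)
  moreover have "(\<Sum>l<M. f (e l) i j) = (\<Sum>z\<in>Z. f z i j)" for i j
    by (rule sum.reindex_bij_betw[OF e])
  ultimately show ?thesis
    using assms(6) by simp
qed

lemma run_For_add_list:
  assumes "ival b s = M" and e: "bij_betw e {..<M} Z"
    and "\<And>l t. \<lbrakk>l < M; e l \<in> Z; unchanged (insert v (iwrites c)) (rwrites c) s t\<rbrakk> \<Longrightarrow>
      rmem (run c (iset v 0 0 l t)) A = (\<lambda>i j. rmem t A i j + f (e l) i j) \<and>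
      cost c (iset v 0 0 l t) \<le> T"
    and "card Z \<le> w" and "icost b + 1 + w * (1 + T) \<le> X"
  shows "rmem (run (For v b c) s) A = (\<lambda>i j. rmem s A i j + (\<Sum>z\<in>Z. f z i j)) \<and>
    cost (For v b c) s \<le> X"
proof -
  have M: "M = card Z"
    using bij_betw_same_card[OF e] by simp
  have "rmem (run (For v b c) s) A = (\<lambda>i j. rmem s A i j + (\<Sum>l<M. f (e l) i j)) \<and>
    cost (For v b c) s \<le> icost b + 1 + M * (1 + T)"
    using assms bij_betwE[OF e] by (intro run_For_add[where T = "\<lambda>_. T"]) auto
  moreover have "M * (1 + T) \<le> w * (1 + T)"
    using assms(4) M by (intro mult_right_mono) auto
  moreover have "(\<Sum>l<M. f (e l) i j) = (\<Sum>z\<in>Z. f z i j)" for i j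
    by (rule sum.reindex_bij_betw[OF e])
  ultimately show ?thesis
    using assms(5) by simp
qed

text \<open>The premise on \<open>g\<close> and \<open>u\<close> ranges over all memories that
  differ from \<open>s\<close> in \<open>v\<close> and \<open>A\<close> only, so the summands must
  not depend on what has been accumulated so far. Vectors use the second index 0, whence the test
  \<open>j = 0\<close>.\<close>

lemma run_For_radd_list:
  assumes "ival b s = M" and "bij_betw e {..<M} Z"
    and "\<And>l t. \<lbrakk>l < M; e l \<in> Z; unchanged {v} {A} s t\<rbrakk> \<Longrightarrow>
      ival g (iset v 0 0 l t) = G (e l) \<and> rval u (iset v 0 0 l t) = F (e l)"
    and "card Z \<le> w" and "icost b + 1 + w * (2 * icost g + rcost u + 6) \<le> X"
  shows "rmem (run (For v b (radd A g (INum 0) u)) s) A =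
      (\<lambda>i j. rmem s A i j + (\<Sum>z\<in>Z. if i = G z \<and> j = 0 then F z else 0)) \<and>
    cost (For v b (radd A g (INum 0) u)) s \<le> X"
proof (rule run_For_add_list[where T = "2 * icost g + rcost u + 5"])
  fix l t
  assume l: "l < M" "e l \<in> Z"
    "unchanged (insert v (iwrites (radd A g (INum 0) u))) (rwrites (radd A g (INum 0) u)) s t"
  then have "ival g (iset v 0 0 l t) = G (e l)" "rval u (iset v 0 0 l t) = F (e l)"
    using assms(3)[of l t] by simp_all
  then show "rmem (run (radd A g (INum 0) u) (iset v 0 0 l t)) A =
      (\<lambda>i j. rmem t A i j + (if i = G (e l) \<and> j = 0 then F (e l) else 0)) \<and>
    cost (radd A g (INum 0) u) (iset v 0 0 l t) \<le> 2 * icost g + rcost u + 5"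
    by (simp add: radd_def fun_eq_iff)
qed (use assms in \<open>simp_all add: add_ac\<close>)

lemma unchanged_refl [simp]: "unchanged I R s s"
  by (simp add: unchanged_def)

lemma unchanged_iset: "a \<in> I \<Longrightarrow> unchanged I R s (iset a x y z t) = unchanged I R s t"
  by (auto simp: unchanged_def)

lemma unchanged_trans:
  "unchanged I R s t \<Longrightarrow> unchanged I' R' t u \<Longrightarrow> I \<union> I' \<subseteq> J \<Longrightarrow> R \<union> R' \<subseteq> T \<Longrightarrow> unchanged J T s u"
  unfolding unchanged_def by (metis Un_iff subsetD)

section \<open>The algorithm\<close>

text \<open>Row \<open>j\<close> of the array \<open>U\<close> is \<open>u\<^sub>j\<close>. The scalars \<open>b\<close>, \<open>g\<close> and \<open>c\<close> are \<open>x \<bullet> q\<^sub>j\<close>, half of \<open>q\<^sub>j \<bullet> q\<^sub>j\<close>,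
  and the negated step length.\<close>

definition transpose_step :: com where
  "transpose_step =
     Seq (ISet ''r'' (INum 0) (INum 0) (IGet ''C_idx'' (ivar ''j'') (ivar ''l'')))
       (accum ''R'' ''R'' ''R_mark'' ''R_len'' ''r'' ''j''
         (RGet ''C_val'' (ivar ''j'') (ivar ''l'')))"

definition transpose_col :: com where
  "transpose_col = For ''l'' (IGet ''C_len'' (ivar ''j'') (INum 0)) transpose_step"

definition transpose_com :: com where
  "transpose_com = For ''j'' (ivar ''p'') transpose_col"

text \<open>Each pair of entries of row \<open>r\<close> is visited in both orders, but only the
  order with \<open>j \<le> h\<close> contributes, and a diagonal pair contributes half a square.
  Equality is what two strict comparisons leave over, since the language has no test for it.\<close>

definition gram_step :: com where
  "gram_step =
     Seq (ISet ''j'' (INum 0) (INum 0) (IGet ''R'' (ivar ''r'') (ivar ''a'')))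
       (Seq (ISet ''h'' (INum 0) (INum 0) (IGet ''R'' (ivar ''r'') (ivar ''b'')))
         (Cond (ILess (ivar ''j'') (ivar ''h''))
           (accum ''W'' ''W'' ''W_mark'' ''W_len'' ''j'' ''h''
             (RMul (RGet ''R'' (ivar ''r'') (ivar ''j'')) (RGet ''R'' (ivar ''r'') (ivar ''h''))))
           (Cond (ILess (ivar ''h'') (ivar ''j'')) Skip
             (accum ''W'' ''W'' ''W_mark'' ''W_len'' ''j'' ''h''
               (RDiv (RMul (RGet ''R'' (ivar ''r'') (ivar ''j'')) (RGet ''R'' (ivar ''r'') (ivar ''h'')))
                 (RNum 2))))))"

definition gram_pairs :: com where
  "gram_pairs = For ''b'' (IGet ''R_len'' (ivar ''r'') (INum 0)) gram_step"

definition gram_row :: com where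
  "gram_row = For ''a'' (IGet ''R_len'' (ivar ''r'') (INum 0)) gram_pairs"

definition gram_com :: com where
  "gram_com = For ''r'' (ivar ''m'') gram_row"

definition overlap_step :: com where
  "overlap_step =
     Seq (ISet ''h'' (INum 0) (INum 0) (IGet ''W'' (ivar ''r'') (ivar ''a'')))
       (accum ''U'' ''U'' ''U_mark'' ''U_len'' ''j'' ''h''
         (RMul (RGet ''D_val'' (ivar ''j'') (ivar ''l'')) (RGet ''W'' (ivar ''r'') (ivar ''h''))))"

text \<open>The product \<open>W\<^sup>T d\<^sub>j\<close> is formed as a combination of rows of
  \<open>W\<close>, one for each entry of \<open>d\<^sub>j\<close>, so the row lists of
  \<open>W\<close> suffice.\<close>

definition overlap_row :: com where
  "overlap_row =
     Seq (ISet ''r'' (INum 0) (INum 0) (IGet ''D_idx'' (ivar ''j'') (ivar ''l'')))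
       (For ''a'' (IGet ''W_len'' (ivar ''r'') (INum 0)) overlap_step)"

definition overlap_col :: com where
  "overlap_col = For ''l'' (IGet ''D_len'' (ivar ''j'') (INum 0)) overlap_row"

definition overlap_com :: com where
  "overlap_com = For ''j'' (ivar ''n'') overlap_col"

lemma writes_transpose [simp]:
  "iwrites transpose_step = {''r'', ''R'', ''R_mark'', ''R_len''}"
  "iwrites transpose_col = {''l'', ''r'', ''R'', ''R_mark'', ''R_len''}"
  "iwrites transpose_com = {''j'', ''l'', ''r'', ''R'', ''R_mark'', ''R_len''}"
  "rwrites transpose_step = {''R''}" "rwrites transpose_col = {''R''}"
  "rwrites transpose_com = {''R''}"
  unfolding transpose_step_def transpose_col_def transpose_com_def
  by (simp_all add: insert_commute)

lemma writes_gram [simp]: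
  "iwrites gram_step = {''j'', ''h'', ''W'', ''W_mark'', ''W_len''}"
  "iwrites gram_pairs = {''b'', ''j'', ''h'', ''W'', ''W_mark'', ''W_len''}"
  "iwrites gram_row = {''a'', ''b'', ''j'', ''h'', ''W'', ''W_mark'', ''W_len''}"
  "iwrites gram_com = {''r'', ''a'', ''b'', ''j'', ''h'', ''W'', ''W_mark'', ''W_len''}"
  "rwrites gram_step = {''W''}" "rwrites gram_pairs = {''W''}"
  "rwrites gram_row = {''W''}" "rwrites gram_com = {''W''}"
  unfolding gram_step_def gram_pairs_def gram_row_def gram_com_def
  by (simp_all add: insert_commute)

lemma writes_overlap [simp]:
  "iwrites overlap_step = {''h'', ''U'', ''U_mark'', ''U_len''}"
  "iwrites overlap_row = {''r'', ''a'', ''h'', ''U'', ''U_mark'', ''U_len''}"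
  "iwrites overlap_col = {''l'', ''r'', ''a'', ''h'', ''U'', ''U_mark'', ''U_len''}"
  "iwrites overlap_com = {''j'', ''l'', ''r'', ''a'', ''h'', ''U'', ''U_mark'', ''U_len''}"
  "rwrites overlap_step = {''U''}" "rwrites overlap_row = {''U''}"
  "rwrites overlap_col = {''U''}" "rwrites overlap_com = {''U''}"
  unfolding overlap_step_def overlap_row_def overlap_col_def overlap_com_def
  by (simp_all add: insert_commute)

section \<open>Programs of the iteration and of its results\<close>

definition init_col :: com where
  "init_col = For ''l'' (IGet ''C_len'' (ivar ''j'') (INum 0))
     (radd ''v'' (ivar ''j'') (INum 0)
       (RMul (RGet ''C_val'' (ivar ''j'') (ivar ''l''))
         (RGet ''x0'' (IGet ''C_idx'' (ivar ''j'') (ivar ''l'')) (INum 0))))"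

text \<open>Starting value \<open>C\<^sup>T x\<^sub>0\<close> of \<open>v\<close>; the vectors
  \<open>z\<close> and \<open>y\<close> start at zero, as does all memory outside the input.\<close>

definition init_com :: com where
  "init_com = For ''j'' (ivar ''p'') init_col"

text \<open>First half \<open>v \<bullet> d\<^sub>j\<close> of the inner product with
  \<open>q\<^sub>j\<close>, over the stored entries of \<open>d\<^sub>j\<close>. The other half
  \<open>z \<bullet> u\<^sub>j\<close> is added by \<open>num_loop'\<close>, over the listed
  positions of \<open>u\<^sub>j\<close>.\<close>

definition num_loop :: com where
  "num_loop = For ''l'' (IGet ''D_len'' (ivar ''j'') (INum 0))
     (radd ''b'' (INum 0) (INum 0)
       (RMul (RGet ''D_val'' (ivar ''j'') (ivar ''l''))
         (RGet ''v'' (IGet ''D_idx'' (ivar ''j'') (ivar ''l'')) (INum 0))))"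

definition den_loop :: com where
  "den_loop = For ''l'' (IGet ''D_len'' (ivar ''j'') (INum 0))
     (radd ''g'' (INum 0) (INum 0)
       (RMul (RGet ''D_val'' (ivar ''j'') (ivar ''l''))
         (RGet ''U'' (ivar ''j'') (IGet ''D_idx'' (ivar ''j'') (ivar ''l'')))))"

definition num_loop' :: com where
  "num_loop' = For ''a'' (IGet ''U_len'' (ivar ''j'') (INum 0))
     (radd ''b'' (INum 0) (INum 0)
       (RMul (RGet ''z'' (IGet ''U'' (ivar ''j'') (ivar ''a'')) (INum 0))
         (RGet ''U'' (ivar ''j'') (IGet ''U'' (ivar ''j'') (ivar ''a'')))))"

definition z_loop :: com where
  "z_loop = For ''l'' (IGet ''D_len'' (ivar ''j'') (INum 0))
     (radd ''z'' (IGet ''D_idx'' (ivar ''j'') (ivar ''l'')) (INum 0)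
       (RMul (rvar ''c'') (RGet ''D_val'' (ivar ''j'') (ivar ''l''))))"

definition v_loop :: com where
  "v_loop = For ''a'' (IGet ''U_len'' (ivar ''j'') (INum 0))
     (radd ''v'' (IGet ''U'' (ivar ''j'') (ivar ''a'')) (INum 0)
       (RMul (rvar ''c'') (RGet ''U'' (ivar ''j'') (IGet ''U'' (ivar ''j'') (ivar ''a'')))))"

text \<open>The accumulators \<open>b\<close> and \<open>g\<close> have to be reset in every
  iteration. Both inner products are complete before \<open>z\<close> and \<open>v\<close> change,
  so they refer to the old iterate. With the step length negated, all updates are additions.\<close>

definition iterate_step :: com where
  "iterate_step =
     Seq (Seq (ISet ''j'' (INum 0) (INum 0) (IGet ''i'' (ivar ''t'') (INum 0)))
       (Seq (RSet ''b'' (INum 0) (INum 0) (RNum 0)) (RSet ''g'' (INum 0) (INum 0) (RNum 0))))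
     (Seq num_loop (Seq den_loop (Seq num_loop'
     (Seq (Seq (RSet ''c'' (INum 0) (INum 0)
         (RSub (RNum 0) (RDiv (rvar ''b'') (RAdd (rvar ''g'') (rvar ''g'')))))
       (radd ''y'' (ivar ''j'') (INum 0) (rvar ''c'')))
     (Seq z_loop v_loop)))))"

definition iterate_com :: com where
  "iterate_com = For ''t'' (ivar ''N'') iterate_step"

text \<open>The iterate is formed explicitly only once, after the loop: \<open>x0\<close> is copied
  and \<open>result_com\<close> adds \<open>C z\<close>.\<close>

definition copy_com :: com where
  "copy_com = For ''r'' (ivar ''m'')
     (radd ''x'' (ivar ''r'') (INum 0) (RGet ''x0'' (ivar ''r'') (INum 0)))"

definition result_col :: com where
  "result_col = For ''l'' (IGet ''C_len'' (ivar ''j'') (INum 0))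
     (radd ''x'' (IGet ''C_idx'' (ivar ''j'') (ivar ''l'')) (INum 0)
       (RMul (RGet ''C_val'' (ivar ''j'') (ivar ''l'')) (RGet ''z'' (ivar ''j'') (INum 0))))"

definition result_com :: com where
  "result_com = For ''j'' (ivar ''p'') result_col"

lemma writes_loops [simp]:
  "iwrites init_col = {''l''}" "rwrites init_col = {''v''}"
  "iwrites init_com = {''j'', ''l''}" "rwrites init_com = {''v''}"
  "iwrites num_loop = {''l''}" "rwrites num_loop = {''b''}"
  "iwrites den_loop = {''l''}" "rwrites den_loop = {''g''}"
  "iwrites num_loop' = {''a''}" "rwrites num_loop' = {''b''}"
  "iwrites z_loop = {''l''}" "rwrites z_loop = {''z''}"
  "iwrites v_loop = {''a''}" "rwrites v_loop = {''v''}"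
  "iwrites copy_com = {''r''}" "rwrites copy_com = {''x''}"
  "iwrites result_col = {''l''}" "rwrites result_col = {''x''}"
  "iwrites result_com = {''j'', ''l''}" "rwrites result_com = {''x''}"
  by (simp_all add: init_col_def init_com_def num_loop_def den_loop_def num_loop'_def z_loop_def
      v_loop_def copy_com_def result_col_def result_com_def)

lemma writes_iterate [simp]:
  "iwrites iterate_step = {''j'', ''l'', ''a''}"
  "rwrites iterate_step = {''b'', ''g'', ''c'', ''y'', ''z'', ''v''}"
  "iwrites iterate_com = {''t'', ''j'', ''l'', ''a''}"
  "rwrites iterate_com = {''b'', ''g'', ''c'', ''y'', ''z'', ''v''}"
  unfolding iterate_com_def iterate_step_def by (simp_all add: insert_commute)

definition main_com :: com where
  "main_com = Seq transpose_com (Seq gram_com (Seq overlap_com (Seq init_com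
     (Seq iterate_com (Seq copy_com result_com)))))"

section \<open>The supports of a sparse factorization\<close>

definition "input_inames = {''m'', ''p'', ''n'', ''N'', ''i'', ''C_len'', ''C_idx'', ''D_len'', ''D_idx''}"
definition "input_rnames = {''x0'', ''C_val'', ''D_val''}"

locale sparse_input =
  fixes m n p k N :: nat and Q C D :: "real mat" and x0 :: "real vec"
    and q :: "nat \<Rightarrow> real vec" and i :: "nat \<Rightarrow> nat" and s0 :: memory
  assumes k_pos: "0 < k"
    and Q [simp]: "Q \<in> carrier_mat m n" and C [simp]: "C \<in> carrier_mat m p"
    and D [simp]: "D \<in> carrier_mat p n" and sparse: "sparse_factorization k Q C D"
    and x0 [simp]: "x0 \<in> carrier_vec m"
    and q: "t < N \<Longrightarrow> i t < n" "t < N \<Longrightarrow> q t = col Q (i t)"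
    and s0: "initial_memory s0 C D x0 N i"
begin

lemmas dims [simp] = carrier_matD[OF C] carrier_matD[OF D] carrier_matD[OF Q] carrier_vecD[OF x0]

abbreviation "clen j \<equiv> imem s0 ''C_len'' j 0"
abbreviation "cidx \<equiv> imem s0 ''C_idx''"
abbreviation "cval \<equiv> rmem s0 ''C_val''"
abbreviation "dlen j \<equiv> imem s0 ''D_len'' j 0"
abbreviation "didx \<equiv> imem s0 ''D_idx''"
abbreviation "dval \<equiv> rmem s0 ''D_val''"

text \<open>All arrays outside the input may have changed. No part of the program writes an input
  array, so the predicate persists, and facts about the stored matrices can be stated for
  \<open>s0\<close> alone.\<close>

definition inputs :: "memory \<Rightarrow> bool" where
  "inputs s \<longleftrightarrow> unchanged (- input_inames) (- input_rnames) s0 s"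

lemma inputs_imem: "inputs s \<Longrightarrow> a \<in> input_inames \<Longrightarrow> imem s a = imem s0 a"
  and inputs_rmem: "inputs s \<Longrightarrow> a \<in> input_rnames \<Longrightarrow> rmem s a = rmem s0 a"
  unfolding inputs_def unchanged_def by blast+

lemma inputs_unchanged:
  "inputs s \<Longrightarrow> unchanged I R s t \<Longrightarrow> I \<inter> input_inames = {} \<Longrightarrow> R \<inter> input_rnames = {} \<Longrightarrow> inputs t"
  unfolding inputs_def by (erule (1) unchanged_trans) auto

lemma inputs_iset [simp]: "a \<notin> input_inames \<Longrightarrow> inputs (iset a x y z s) = inputs s"
  unfolding inputs_def by (intro unchanged_iset) (simp only: Compl_iff not_False_eq_True)

lemma input_values:
  "imem s0 ''m'' 0 0 = dim_row C" "imem s0 ''p'' 0 0 = dim_col C" "imem s0 ''n'' 0 0 = dim_col D"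
  "imem s0 ''N'' 0 0 = N" "\<forall>t<N. imem s0 ''i'' t 0 = i t"
  "\<forall>r<dim_vec x0. rmem s0 ''x0'' r 0 = x0 $ r"
  "sparse_columns (\<lambda>j. imem s0 ''C_len'' j 0) (imem s0 ''C_idx'') (rmem s0 ''C_val'') C"
  "sparse_columns (\<lambda>j. imem s0 ''D_len'' j 0) (imem s0 ''D_idx'') (rmem s0 ''D_val'') D"
  "\<forall>a. a \<notin> input_inames \<longrightarrow> imem s0 a = (\<lambda>_ _. 0)" "\<forall>a. a \<notin> input_rnames \<longrightarrow> rmem s0 a = (\<lambda>_ _. 0)"
  using s0 unfolding initial_memory_def input_inames_def input_rnames_def by - (elim conjE, assumption)+

lemma s0_simps [simp]:
  "imem s0 ''m'' 0 0 = m" "imem s0 ''p'' 0 0 = p" "imem s0 ''n'' 0 0 = n" "imem s0 ''N'' 0 0 = N"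
  "t < N \<Longrightarrow> imem s0 ''i'' t 0 = i t" "r < m \<Longrightarrow> rmem s0 ''x0'' r 0 = x0 $ r"
  using input_values(1-6) by simp_all

section \<open>Supports of the factors, and the matrices \<open>W\<close> and
  \<open>U\<close>\<close>

definition rowset :: "nat \<Rightarrow> nat set" where
  "rowset r = {j. j < p \<and> r < m \<and> C $$ (r, j) \<noteq> 0}"

text \<open>Row sets are empty and entries zero outside the matrix, in agreement with the zero
  memory there. So \<open>sparse_rows\<close>, which speaks of all indices, holds without range
  conditions.\<close>

definition entry :: "nat \<Rightarrow> nat \<Rightarrow> real" where
  "entry r j = (if j \<in> rowset r then C $$ (r, j) else 0)"

definition overlap :: "nat \<Rightarrow> nat set" where
  "overlap j = {h. j \<le> h \<and> (\<exists>r<m. j \<in> rowset r \<and> h \<in> rowset r)}"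

text \<open>The terms of the Gram matrix of \<open>C\<close> on or above the diagonal, with the diagonal halved: the
  Gram matrix is then the sum of \<open>W\<close> and its transpose (see \<open>gram_eq\<close>).\<close>

definition gram_term :: "nat \<Rightarrow> nat \<Rightarrow> nat \<Rightarrow> real" where
  "gram_term r j h =
     (if j < h then entry r j * entry r h else if h < j then 0 else entry r j * entry r h / 2)"

definition W :: "nat \<Rightarrow> nat \<Rightarrow> real" where
  "W j h = (\<Sum>r<m. gram_term r j h)"

definition colset :: "nat \<Rightarrow> nat set" where
  "colset j = {h. h < p \<and> j < n \<and> D $$ (h, j) \<noteq> 0}"

text \<open>The union whose cardinality is bounded in a \<open>k\<close>-sparse factorization. It
  contains the support of \<open>u\<^sub>j\<close>, possibly strictly, as sums may cancel.\<close>

definition uset :: "nat \<Rightarrow> nat set" where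
  "uset j = (\<Union>h\<in>colset j. overlap h)"

definition U :: "nat \<Rightarrow> nat \<Rightarrow> real" where
  "U j h = (\<Sum>r \<in> colset j. D $$ (r, j) * W r h)"

lemma C_storage:
  assumes "j < p"
  shows "bij_betw (cidx j) {..<clen j} {r. j \<in> rowset r}" "l < clen j \<Longrightarrow> cval j l = entry (cidx j l) j"
proof -
  have "bij_betw (cidx j) {..<clen j} (supp (col C j)) \<and> (\<forall>l<clen j. cval j l = col C j $ cidx j l)"
    using assms input_values(7) by (simp add: sparse_columns_def)
  moreover have "supp (col C j) = {r. j \<in> rowset r}"
    using assms by (auto simp: supp_def rowset_def)
  ultimately show bij: "bij_betw (cidx j) {..<clen j} {r. j \<in> rowset r}"
    and "l < clen j \<Longrightarrow> cval j l = entry (cidx j l) j"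
    using C assms bij_betwE[of "cidx j" "{..<clen j}" "{r. j \<in> rowset r}"]
    by (auto simp: entry_def rowset_def)
qed

lemma D_storage:
  assumes "j < n"
  shows "bij_betw (didx j) {..<dlen j} (colset j)" "l < dlen j \<Longrightarrow> dval j l = D $$ (didx j l, j)"
proof -
  have "bij_betw (didx j) {..<dlen j} (supp (col D j)) \<and> (\<forall>l<dlen j. dval j l = col D j $ didx j l)"
    using assms input_values(8) by (simp add: sparse_columns_def)
  moreover have "supp (col D j) = colset j"
    using assms D by (auto simp: supp_def colset_def)
  ultimately show bij: "bij_betw (didx j) {..<dlen j} (colset j)"
    and "l < dlen j \<Longrightarrow> dval j l = D $$ (didx j l, j)"
    using D assms bij_betwE[of "didx j" "{..<dlen j}" "colset j"]
    by (auto simp: colset_def)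
qed

lemma overlap_eq: "j < p \<Longrightarrow> forward_overlap C j = overlap j"
  using C by (auto simp: forward_overlap_def overlap_def supp_def rowset_def)

lemma finite_sets [simp]: "finite (rowset r)" "finite (colset j)" "finite (overlap j)"
  by (auto simp: rowset_def colset_def overlap_def)

section \<open>Bounds on the cardinalities of the supports\<close>

lemma card_uset: "j < n \<Longrightarrow> card (uset j) \<le> k"
proof -
  assume j: "j < n"
  have "supp (col D j) = colset j"
    using j D by (auto simp: supp_def colset_def)
  then have "(\<Union>i \<in> supp (col D j). forward_overlap C i) = uset j"
    using overlap_eq by (auto simp: colset_def uset_def)
  then show ?thesis
    using sparse j D by (auto simp: sparse_factorization_def)
qed

text \<open>A nonzero column shares a row with itself; the convention on the columns of
  \<open>C\<close> enters here.\<close>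

lemma self_overlap: "j < p \<Longrightarrow> j \<in> overlap j"
proof -
  assume j: "j < p"
  then have "col C j \<noteq> 0\<^sub>v m"
    using sparse C by (auto simp: sparse_factorization_def)
  then obtain r where "r < m" "C $$ (r, j) \<noteq> 0"
    using C j by (auto simp: vec_eq_iff)
  then show ?thesis
    using j by (auto simp: overlap_def rowset_def)
qed

text \<open>This is the convention that no row of \<open>D\<close> is zero. It lets bounds for the
  columns of \<open>D\<close> control the columns of \<open>C\<close>.\<close>

lemma in_colset: "h < p \<Longrightarrow> \<exists>j<n. h \<in> colset j"
proof -
  assume h: "h < p"
  then have "row D h \<noteq> 0\<^sub>v n"
    using sparse D by (auto simp: sparse_factorization_def)
  then show ?thesis
    using D h by (auto simp: vec_eq_iff colset_def)
qed

text \<open>By \<open>self_overlap\<close>, every index in the support of \<open>d\<^sub>j\<close>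
  lies in its own forward overlap and hence in \<open>uset j\<close>.\<close>

lemma card_colset:
  assumes "j < n"
  shows "card (colset j) \<le> k"
proof -
  have "colset j \<subseteq> uset j"
    using self_overlap unfolding uset_def colset_def by blast
  then have "card (colset j) \<le> card (uset j)"
    by (intro card_mono) (auto simp: uset_def)
  then show ?thesis
    using card_uset[OF assms] by simp
qed

text \<open>Some column of \<open>D\<close> has an entry in row \<open>h\<close>, and its
  \<open>uset\<close> contains the forward overlap of \<open>h\<close>.\<close>

lemma card_overlap: "h < p \<Longrightarrow> card (overlap h) \<le> k"
proof -
  assume "h < p"
  then obtain j where j: "j < n" "h \<in> colset j"
    using in_colset by blast
  then have "card (overlap h) \<le> card (uset j)"
    by (intro card_mono) (auto simp: uset_def)
  then show ?thesis
    using card_uset[OF j(1)] by simp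
qed

text \<open>All columns meeting row \<open>r\<close> lie in the forward overlap of the first of them.\<close>

lemma card_rowset: "card (rowset r) \<le> k"
proof (cases "rowset r = {}")
  case False
  let ?h = "Min (rowset r)"
  have h: "?h \<in> rowset r"
    using False by simp
  then have "rowset r \<subseteq> overlap ?h"
    by (auto simp: overlap_def) (auto simp: rowset_def)
  then have "card (rowset r) \<le> card (overlap ?h)"
    by (intro card_mono) auto
  moreover have "?h < p"
    using h unfolding rowset_def by blast
  ultimately show ?thesis
    using card_overlap[of ?h] by simp
qed simp

text \<open>The supports of the \<open>n\<close> columns of \<open>D\<close> cover all row indices,
  and each has at most \<open>k\<close> elements. This eliminates \<open>p\<close> from the final
  bound.\<close>

lemma p_le: "p \<le> n * k"
proof -
  have "{..<p} \<subseteq> (\<Union>j<n. colset j)"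
    using in_colset by auto
  then have "p \<le> card (\<Union>j<n. colset j)"
    using card_mono[of "\<Union>j<n. colset j" "{..<p}"] by simp
  also have "\<dots> \<le> (\<Sum>j<n. card (colset j))"
    by (rule card_UN_le) simp
  also have "\<dots> \<le> n * k"
    using sum_bounded_above[of "{..<n}" "\<lambda>j. card (colset j)" k] card_colset by simp
  finally show ?thesis .
qed

text \<open>Double counting: the nonzero entries of \<open>C\<close> are counted by columns and then
  by rows, each of which has at most \<open>k\<close> of them.\<close>

lemma sum_clen: "(\<Sum>j<p. clen j) \<le> m * k"
proof -
  have "(\<Sum>j<p. clen j) = (\<Sum>j<p. \<Sum>r<m. if j \<in> rowset r then 1 else 0)"
  proof (rule sum.cong)
    fix j assume "j \<in> {..<p}"
    then have "clen j = card {r. j \<in> rowset r}"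
      using bij_betw_same_card[OF C_storage(1)[of j]] by simp
    also have "{r. j \<in> rowset r} = {r\<in>{..<m}. j \<in> rowset r}"
      by (auto simp: rowset_def)
    finally show "clen j = (\<Sum>r<m. if j \<in> rowset r then 1 else 0)"
      by (simp add: sum.If_cases Int_def)
  qed simp
  also have "\<dots> = (\<Sum>r<m. \<Sum>j<p. if j \<in> rowset r then 1 else 0)"
    by (rule sum.swap)
  also have "\<dots> \<le> (\<Sum>r<m. k)"
  proof (rule sum_mono)
    fix r
    have "{..<p} \<inter> rowset r = rowset r"
      by (auto simp: rowset_def)
    then show "(\<Sum>j<p. if j \<in> rowset r then 1 else 0) \<le> k"
      using card_rowset[of r] by (simp add: sum.If_cases)
  qed
  finally show ?thesis by simp
qed

subsection \<open>Precomputation\<close>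

lemmas input_simps = inputs_imem inputs_rmem input_inames_def input_rnames_def

section \<open>The row lists of \<open>C\<close>\<close>

lemma run_transpose_step:
  assumes s: "inputs s" "imem s ''j'' 0 0 = j" "imem s ''l'' 0 0 = l"
    and rows: "sparse_rows ''R'' ''R'' ''R_mark'' ''R_len'' s V S"
  shows "sparse_rows ''R'' ''R'' ''R_mark'' ''R_len'' (run transpose_step s)
      (\<lambda>a b. V a b + (if a = cidx j l \<and> b = j then cval j l else 0))
      (\<lambda>a. S a \<union> (if a = cidx j l then {j} else {})) \<and>
    cost transpose_step s \<le> 90"
  using assms unfolding transpose_step_def
  by (simp add: input_simps, intro run_accum) (simp_all add: input_simps)

lemma run_transpose_col:
  assumes s: "inputs s" "imem s ''j'' 0 0 = j"
    and rows: "sparse_rows ''R'' ''R'' ''R_mark'' ''R_len'' s V S"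
  shows "sparse_rows ''R'' ''R'' ''R_mark'' ''R_len'' (run transpose_col s)
      (\<lambda>a b. V a b + (\<Sum>l<clen j. if a = cidx j l \<and> b = j then cval j l else 0))
      (\<lambda>a. S a \<union> (\<Union>l<clen j. if a = cidx j l then {j} else {})) \<and>
    cost transpose_col s \<le> 100 * (1 + clen j)"
  unfolding transpose_col_def
proof (rule run_For_accum[where T = "\<lambda>_. 90"])
  fix l t V S
  assume t: "unchanged (insert ''l'' (iwrites transpose_step)) (rwrites transpose_step) s t"
    "sparse_rows ''R'' ''R'' ''R_mark'' ''R_len'' t V S"
  have "inputs t"
    by (rule inputs_unchanged[OF s(1) t(1)]) (simp_all add: input_simps)
  moreover have "imem t ''j'' = imem s ''j''"
    using t(1) by (simp add: unchanged_def)
  ultimately show "sparse_rows ''R'' ''R'' ''R_mark'' ''R_len'' (run transpose_step (iset ''l'' 0 0 l t))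
      (\<lambda>a b. V a b + (if a = cidx j l \<and> b = j then cval j l else 0))
      (\<lambda>a. S a \<union> (if a = cidx j l then {j} else {})) \<and>
    cost transpose_step (iset ''l'' 0 0 l t) \<le> 90"
    using t(2) s by (intro run_transpose_step) (simp_all add: input_simps)
qed (use s rows in \<open>simp_all add: input_simps\<close>)

text \<open>Single columns of \<open>C\<close> can be long, so each is charged with its own length,
  and only the total is estimated, by \<open>sum_clen\<close>.\<close>

lemma run_transpose:
  assumes s: "inputs s"
    and rows: "sparse_rows ''R'' ''R'' ''R_mark'' ''R_len'' s (\<lambda>_ _. 0) (\<lambda>_. {})"
  shows "sparse_rows ''R'' ''R'' ''R_mark'' ''R_len'' (run transpose_com s) entry rowset \<and>
    cost transpose_com s \<le> 200 * (1 + p + m * k)"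
proof -
  \<comment> \<open>The terms \<open>0 +\<close> and \<open>{} \<union>\<close> are kept so that
    both expressions match the conclusion of \<open>run_For_accum\<close> for the empty
    matrix.\<close>
  let ?V = "\<lambda>a b. 0 + (\<Sum>j<p. \<Sum>l<clen j. if a = cidx j l \<and> b = j then cval j l else 0)"
  let ?S = "\<lambda>a. {} \<union> (\<Union>j<p. \<Union>l<clen j. if a = cidx j l then {j} else {})"
  have "sparse_rows ''R'' ''R'' ''R_mark'' ''R_len'' (run transpose_com s) ?V ?S \<and>
    cost transpose_com s \<le> 200 * (1 + p + m * k)"
    unfolding transpose_com_def
  proof (rule run_For_accum[where T = "\<lambda>j. 100 * (1 + clen j)"])
    fix j t V S
    assume t: "unchanged (insert ''j'' (iwrites transpose_col)) (rwrites transpose_col) s t"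
      "sparse_rows ''R'' ''R'' ''R_mark'' ''R_len'' t V S"
    have "inputs t"
      by (rule inputs_unchanged[OF s(1) t(1)]) (simp_all add: input_simps)
    then show "sparse_rows ''R'' ''R'' ''R_mark'' ''R_len'' (run transpose_col (iset ''j'' 0 0 j t))
        (\<lambda>a b. V a b + (\<Sum>l<clen j. if a = cidx j l \<and> b = j then cval j l else 0))
        (\<lambda>a. S a \<union> (\<Union>l<clen j. if a = cidx j l then {j} else {})) \<and>
      cost transpose_col (iset ''j'' 0 0 j t) \<le> 100 * (1 + clen j)"
      using t(2) s by (intro run_transpose_col) (simp_all add: input_simps)
  next
    show "icost (ivar ''p'') + 1 + (\<Sum>l<p. 1 + 100 * (1 + clen l)) \<le> 200 * (1 + p + m * k)"
      using sum_clen by (simp add: sum.distrib flip: sum_distrib_left)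
  qed (use s rows in \<open>simp_all add: input_simps\<close>)
  moreover have "?S = rowset"
  proof
    fix a
    have "a \<in> cidx j ` {..<clen j} \<longleftrightarrow> j \<in> rowset a" if "j < p" for j
      using C_storage(1)[OF that] by (simp add: bij_betw_def)
    then show "?S a = rowset a"
      by (auto split: if_splits) (auto simp: rowset_def)
  qed
  moreover have "?V = entry"
  proof (intro ext)
    fix a b
    have "(\<Sum>l<clen j. if a = cidx j l \<and> b = j then cval j l else 0) = (if b = j then entry a j else 0)"
      if "j < p" for j
    proof -
      have "(\<Sum>l<clen j. if a = cidx j l \<and> b = j then cval j l else 0)
        = (\<Sum>l<clen j. if a = cidx j l \<and> b = j then entry (cidx j l) j else 0)"
        using C_storage(2)[OF that] by (intro sum.cong) auto
      also have "\<dots> = (\<Sum>r | j \<in> rowset r. if a = r \<and> b = j then entry r j else 0)"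
        by (rule sum.reindex_bij_betw[OF C_storage(1)[OF that]])
      also have "\<dots> = (if b = j then entry a j else 0)"
        using finite_subset[of "{r. j \<in> rowset r}" "{..<m}"]
        by (auto simp: entry_def sum.delta rowset_def)
      finally show ?thesis .
    qed
    then have "?V a b = (\<Sum>j<p. if b = j then entry a j else 0)"
      by simp
    also have "\<dots> = entry a b"
      by (auto simp: entry_def rowset_def)
    finally show "?V a b = entry a b" .
  qed
  ultimately show ?thesis
    by metis
qed

lemma k_le_square: "k \<le> k\<^sup>2"
  using k_pos by (simp add: power2_eq_square)

section \<open>The matrix \<open>W\<close> from the pairs of entries in each row\<close>

lemma run_gram_step:
  assumes s: "imem s ''r'' 0 0 = r" "imem s ''R'' r (imem s ''a'' 0 0) = j"
      "imem s ''R'' r (imem s ''b'' 0 0) = h" "rmem s ''R'' = entry"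
    and rows: "sparse_rows ''W'' ''W'' ''W_mark'' ''W_len'' s V S"
  shows "sparse_rows ''W'' ''W'' ''W_mark'' ''W_len'' (run gram_step s)
      (\<lambda>x y. V x y + (if x = j \<and> y = h then gram_term r j h else 0))
      (\<lambda>x. S x \<union> (if x = j then if h < j then {} else {h} else {})) \<and>
    cost gram_step s \<le> 150"
proof -
  consider "j < h" | "h < j" | "j = h"
    by linarith
  then show ?thesis
  proof cases
    case 1
    then show ?thesis
      using assms unfolding gram_step_def
      by (simp, intro run_accum) (simp_all add: gram_term_def)
  next
    case 2
    \<comment> \<open>The skipped pair has \<open>gram_term\<close> zero, so the required update is
      no change.\<close>
    then have *: "(\<lambda>x y. V x y + (if x = j \<and> y = h then gram_term r j h else 0)) = V"
      by (auto simp: gram_term_def fun_eq_iff)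
    show ?thesis
      unfolding * using 2 assms by (simp add: gram_step_def)
  next
    case 3
    then show ?thesis
      using assms unfolding gram_step_def
      by (simp, intro run_accum) (simp_all add: gram_term_def)
  qed
qed

lemma run_gram_pairs:
  assumes s: "imem s ''r'' 0 0 = r" "imem s ''R'' r (imem s ''a'' 0 0) = j"
    and R: "sparse_rows ''R'' ''R'' ''R_mark'' ''R_len'' s entry rowset"
    and rows: "sparse_rows ''W'' ''W'' ''W_mark'' ''W_len'' s V S"
  shows "sparse_rows ''W'' ''W'' ''W_mark'' ''W_len'' (run gram_pairs s)
      (\<lambda>x y. V x y + (\<Sum>h\<in>rowset r. if x = j \<and> y = h then gram_term r j h else 0))
      (\<lambda>x. S x \<union> (\<Union>h\<in>rowset r. if x = j then if h < j then {} else {h} else {})) \<and>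
    cost gram_pairs s \<le> 160 * k"
  unfolding gram_pairs_def
proof (rule run_For_accum_list[where T = 150 and e = "imem s ''R'' r"])
  show "bij_betw (imem s ''R'' r) {..<imem s ''R_len'' r 0} (rowset r)"
    using R by (simp add: sparse_rows_def)
next
  fix l t V S
  assume t: "unchanged (insert ''b'' (iwrites gram_step)) (rwrites gram_step) s t"
    "sparse_rows ''W'' ''W'' ''W_mark'' ''W_len'' t V S"
  then have "imem t ''R'' = imem s ''R''" "imem t ''r'' = imem s ''r''" "imem t ''a'' = imem s ''a''"
    "rmem t ''R'' = entry"
    using R by (simp_all add: unchanged_def sparse_rows_def)
  then show "sparse_rows ''W'' ''W'' ''W_mark'' ''W_len'' (run gram_step (iset ''b'' 0 0 l t))
      (\<lambda>x y. V x y + (if x = j \<and> y = imem s ''R'' r l then gram_term r j (imem s ''R'' r l) else 0))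
      (\<lambda>x. S x \<union> (if x = j then if imem s ''R'' r l < j then {} else {imem s ''R'' r l} else {})) \<and>
    cost gram_step (iset ''b'' 0 0 l t) \<le> 150"
    using s t(2) by (intro run_gram_step) simp_all
next
  show "icost (IGet ''R_len'' (ivar ''r'') (INum 0)) + 1 + k * (1 + 150) \<le> 160 * k"
    using k_pos by simp
qed (use s rows card_rowset[of r] in simp_all)

lemma run_gram_row:
  assumes s: "imem s ''r'' 0 0 = r"
    and R: "sparse_rows ''R'' ''R'' ''R_mark'' ''R_len'' s entry rowset"
    and rows: "sparse_rows ''W'' ''W'' ''W_mark'' ''W_len'' s V S"
  shows "sparse_rows ''W'' ''W'' ''W_mark'' ''W_len'' (run gram_row s)
      (\<lambda>x y. V x y + (\<Sum>j\<in>rowset r. \<Sum>h\<in>rowset r. if x = j \<and> y = h then gram_term r j h else 0))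
      (\<lambda>x. S x \<union> (\<Union>j\<in>rowset r. \<Union>h\<in>rowset r. if x = j then if h < j then {} else {h} else {})) \<and>
    cost gram_row s \<le> 170 * k\<^sup>2"
  unfolding gram_row_def
proof (rule run_For_accum_list[where T = "160 * k" and e = "imem s ''R'' r"])
  show "bij_betw (imem s ''R'' r) {..<imem s ''R_len'' r 0} (rowset r)"
    using R by (simp add: sparse_rows_def)
next
  fix l t V S
  assume t: "unchanged (insert ''a'' (iwrites gram_pairs)) (rwrites gram_pairs) s t"
    "sparse_rows ''W'' ''W'' ''W_mark'' ''W_len'' t V S"
  have "sparse_rows ''R'' ''R'' ''R_mark'' ''R_len'' t entry rowset"
    by (rule sparse_rows_unchanged[OF R t(1)]) simp_all
  moreover have "imem t ''R'' = imem s ''R''" "imem t ''r'' = imem s ''r''"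
    using t(1) by (simp_all add: unchanged_def)
  ultimately show "sparse_rows ''W'' ''W'' ''W_mark'' ''W_len'' (run gram_pairs (iset ''a'' 0 0 l t))
      (\<lambda>x y. V x y + (\<Sum>h\<in>rowset r. if x = imem s ''R'' r l \<and> y = h then gram_term r (imem s ''R'' r l) h else 0))
      (\<lambda>x. S x \<union> (\<Union>h\<in>rowset r. if x = imem s ''R'' r l then if h < imem s ''R'' r l then {} else {h} else {})) \<and>
    cost gram_pairs (iset ''a'' 0 0 l t) \<le> 160 * k"
    using s t(2) by (intro run_gram_pairs) simp_all
next
  have "k * (1 + 160 * k) = k + 160 * k\<^sup>2"
    by (simp add: power2_eq_square algebra_simps)
  moreover have "icost (IGet ''R_len'' (ivar ''r'') (INum 0)) + 1 = 6"
    by simp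
  ultimately show "icost (IGet ''R_len'' (ivar ''r'') (INum 0)) + 1 + k * (1 + 160 * k) \<le> 170 * k\<^sup>2"
    using k_pos k_le_square by linarith
qed (use s rows card_rowset[of r] in simp_all)

lemma run_gram:
  assumes s: "inputs s"
    and R: "sparse_rows ''R'' ''R'' ''R_mark'' ''R_len'' s entry rowset"
    and rows: "sparse_rows ''W'' ''W'' ''W_mark'' ''W_len'' s (\<lambda>_ _. 0) (\<lambda>_. {})"
  shows "sparse_rows ''W'' ''W'' ''W_mark'' ''W_len'' (run gram_com s) W overlap \<and>
    cost gram_com s \<le> 10 + m * (1 + 170 * k\<^sup>2)"
proof -
  let ?V = "\<lambda>x y. 0 + (\<Sum>r<m. \<Sum>j\<in>rowset r. \<Sum>h\<in>rowset r. if x = j \<and> y = h then gram_term r j h else 0)"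
  let ?S = "\<lambda>x. {} \<union> (\<Union>r<m. \<Union>j\<in>rowset r. \<Union>h\<in>rowset r. if x = j then if h < j then {} else {h} else {})"
  have "sparse_rows ''W'' ''W'' ''W_mark'' ''W_len'' (run gram_com s) ?V ?S \<and>
    cost gram_com s \<le> 10 + m * (1 + 170 * k\<^sup>2)"
    unfolding gram_com_def
  proof (rule run_For_accum[where T = "\<lambda>_. 170 * k\<^sup>2"])
    fix r t V S
    assume t: "unchanged (insert ''r'' (iwrites gram_row)) (rwrites gram_row) s t"
      "sparse_rows ''W'' ''W'' ''W_mark'' ''W_len'' t V S"
    have "sparse_rows ''R'' ''R'' ''R_mark'' ''R_len'' t entry rowset"
      by (rule sparse_rows_unchanged[OF R t(1)]) simp_all
    then show "sparse_rows ''W'' ''W'' ''W_mark'' ''W_len'' (run gram_row (iset ''r'' 0 0 r t))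
        (\<lambda>x y. V x y + (\<Sum>j\<in>rowset r. \<Sum>h\<in>rowset r. if x = j \<and> y = h then gram_term r j h else 0))
        (\<lambda>x. S x \<union> (\<Union>j\<in>rowset r. \<Union>h\<in>rowset r. if x = j then if h < j then {} else {h} else {})) \<and>
      cost gram_row (iset ''r'' 0 0 r t) \<le> 170 * k\<^sup>2"
      using t(2) by (intro run_gram_row) simp_all
  qed (use s rows in \<open>simp_all add: input_simps\<close>)
  moreover have "?S = overlap"
    by (auto simp: overlap_def fun_eq_iff split: if_splits)
  moreover have "?V = W"
  proof (intro ext)
    fix x y
    \<comment> \<open>The conditions select the pair \<open>(x, y)\<close>. If one of the two is not
      in \<open>rowset r\<close>, its entry is zero, and so is
      \<open>gram_term r x y\<close>.\<close>
    have "(\<Sum>j\<in>rowset r. \<Sum>h\<in>rowset r. if x = j \<and> y = h then gram_term r j h else 0)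
      = gram_term r x y" for r
    proof -
      have "(\<Sum>h\<in>rowset r. if x = j \<and> y = h then gram_term r j h else 0)
        = (if x = j then if y \<in> rowset r then gram_term r j y else 0 else 0)" for j
        by auto
      then show ?thesis
        by (auto simp: gram_term_def entry_def)
    qed
    then show "?V x y = W x y"
      by (simp add: W_def)
  qed
  ultimately show ?thesis
    by metis
qed

text \<open>If \<open>x \<le> y\<close>, no row meets both columns and each product contains a zero
  entry; if \<open>y < x\<close>, each term is zero by definition.\<close>

lemma W_eq_0: "y \<notin> overlap x \<Longrightarrow> W x y = 0"
  by (force simp: W_def overlap_def gram_term_def entry_def intro!: sum.neutral)

section \<open>The vectors \<open>u\<^sub>j\<close>\<close>

lemma run_overlap_step:
  assumes s: "inputs s" "imem s ''j'' 0 0 = j" "imem s ''l'' 0 0 = l" "imem s ''r'' 0 0 = r"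
      "imem s ''W'' r (imem s ''a'' 0 0) = h" "rmem s ''W'' = W"
    and rows: "sparse_rows ''U'' ''U'' ''U_mark'' ''U_len'' s V S"
  shows "sparse_rows ''U'' ''U'' ''U_mark'' ''U_len'' (run overlap_step s)
      (\<lambda>x y. V x y + (if x = j \<and> y = h then dval j l * W r h else 0))
      (\<lambda>x. S x \<union> (if x = j then {h} else {})) \<and>
    cost overlap_step s \<le> 150"
  using assms unfolding overlap_step_def
  by (simp add: input_simps, intro run_accum) (simp_all add: input_simps)

lemma run_overlap_row:
  assumes s: "inputs s" "imem s ''j'' 0 0 = j" "imem s ''l'' 0 0 = l" "didx j l = r" "r < p"
    and W: "sparse_rows ''W'' ''W'' ''W_mark'' ''W_len'' s W overlap"
    and rows: "sparse_rows ''U'' ''U'' ''U_mark'' ''U_len'' s V S"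
  shows "sparse_rows ''U'' ''U'' ''U_mark'' ''U_len'' (run overlap_row s)
      (\<lambda>x y. V x y + (\<Sum>h\<in>overlap r. if x = j \<and> y = h then dval j l * W r h else 0))
      (\<lambda>x. S x \<union> (\<Union>h\<in>overlap r. if x = j then {h} else {})) \<and>
    cost overlap_row s \<le> 180 * k"
proof -
  let ?for = "For ''a'' (IGet ''W_len'' (ivar ''r'') (INum 0)) overlap_step"
  let ?s = "iset ''r'' 0 0 r s"
  have "sparse_rows ''U'' ''U'' ''U_mark'' ''U_len'' (run ?for ?s)
      (\<lambda>x y. V x y + (\<Sum>h\<in>overlap r. if x = j \<and> y = h then dval j l * W r h else 0))
      (\<lambda>x. S x \<union> (\<Union>h\<in>overlap r. if x = j then {h} else {})) \<and>
    cost ?for ?s \<le> 160 * k"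
  proof (rule run_For_accum_list[where T = 150 and e = "imem s ''W'' r"])
    show "bij_betw (imem s ''W'' r) {..<imem s ''W_len'' r 0} (overlap r)"
      using W by (simp add: sparse_rows_def)
  next
    fix a t V S
    assume t: "unchanged (insert ''a'' (iwrites overlap_step)) (rwrites overlap_step) ?s t"
      "sparse_rows ''U'' ''U'' ''U_mark'' ''U_len'' t V S"
    have "inputs t"
      using s(1) by (intro inputs_unchanged[OF _ t(1)]) (simp_all add: input_simps)
    moreover have "imem t ''W'' = imem s ''W''" "imem t ''r'' 0 0 = r" "imem t ''j'' = imem s ''j''"
      "imem t ''l'' = imem s ''l''" "rmem t ''W'' = W"
      using t(1) W by (simp_all add: unchanged_def sparse_rows_def)
    ultimately show "sparse_rows ''U'' ''U'' ''U_mark'' ''U_len'' (run overlap_step (iset ''a'' 0 0 a t))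
        (\<lambda>x y. V x y + (if x = j \<and> y = imem s ''W'' r a then dval j l * W r (imem s ''W'' r a) else 0))
        (\<lambda>x. S x \<union> (if x = j then {imem s ''W'' r a} else {})) \<and>
      cost overlap_step (iset ''a'' 0 0 a t) \<le> 150"
      using s t(2) by (intro run_overlap_step) (simp_all add: input_simps)
  next
    show "icost (IGet ''W_len'' (ivar ''r'') (INum 0)) + 1 + k * (1 + 150) \<le> 160 * k"
      using k_pos by simp
  qed (use rows card_overlap[OF s(5)] in simp_all)
  \<comment> \<open>The 10 is the cost of the assignment to \<open>r\<close>.\<close>
  moreover have "run overlap_row s = run ?for ?s" "cost overlap_row s = 10 + cost ?for ?s"
    using s by (simp_all add: overlap_row_def input_simps del: run.simps(6) cost.simps(6))
  ultimately show ?thesis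
    using k_pos by (auto simp del: run.simps(6) cost.simps(6))
qed

lemma run_overlap_col:
  assumes s: "inputs s" "imem s ''j'' 0 0 = j" and j: "j < n"
    and W: "sparse_rows ''W'' ''W'' ''W_mark'' ''W_len'' s W overlap"
    and rows: "sparse_rows ''U'' ''U'' ''U_mark'' ''U_len'' s V S"
  shows "sparse_rows ''U'' ''U'' ''U_mark'' ''U_len'' (run overlap_col s)
      (\<lambda>x y. V x y + (\<Sum>r\<in>colset j. \<Sum>h\<in>overlap r. if x = j \<and> y = h then D $$ (r, j) * W r h else 0))
      (\<lambda>x. S x \<union> (\<Union>r\<in>colset j. \<Union>h\<in>overlap r. if x = j then {h} else {})) \<and>
    cost overlap_col s \<le> 200 * k\<^sup>2"
  unfolding overlap_col_def
proof (rule run_For_accum_list[where T = "180 * k" and e = "didx j"])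
  show "bij_betw (didx j) {..<dlen j} (colset j)"
    by (rule D_storage(1)[OF j])
next
  fix l t V S
  assume l: "l < dlen j" "didx j l \<in> colset j"
    and t: "unchanged (insert ''l'' (iwrites overlap_row)) (rwrites overlap_row) s t"
    "sparse_rows ''U'' ''U'' ''U_mark'' ''U_len'' t V S"
  have "inputs t"
    using s(1) by (intro inputs_unchanged[OF _ t(1)]) (simp_all add: input_simps)
  moreover have "sparse_rows ''W'' ''W'' ''W_mark'' ''W_len'' t W overlap"
    by (rule sparse_rows_unchanged[OF W t(1)]) simp_all
  moreover have "imem t ''j'' = imem s ''j''"
    using t(1) by (simp_all add: unchanged_def)
  moreover have "didx j l < p"
    using l(2) by (simp add: colset_def)
  ultimately show "sparse_rows ''U'' ''U'' ''U_mark'' ''U_len'' (run overlap_row (iset ''l'' 0 0 l t))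
      (\<lambda>x y. V x y + (\<Sum>h\<in>overlap (didx j l).
        if x = j \<and> y = h then D $$ (didx j l, j) * W (didx j l) h else 0))
      (\<lambda>x. S x \<union> (\<Union>h\<in>overlap (didx j l). if x = j then {h} else {})) \<and>
    cost overlap_row (iset ''l'' 0 0 l t) \<le> 180 * k"
    \<comment> \<open>The goal speaks of the entry at \<open>didx j l\<close>, because the loop rule
      needs a function of the list element; the lemma on a row speaks of the stored value.\<close>
    unfolding D_storage(2)[OF j l(1), symmetric]
    using s t(2) by (intro run_overlap_row) (simp_all add: input_simps)
next
  have "k * (1 + 180 * k) = k + 180 * k\<^sup>2"
    by (simp add: power2_eq_square algebra_simps)
  moreover have "icost (IGet ''D_len'' (ivar ''j'') (INum 0)) + 1 = 6"
    by simp
  ultimately show "icost (IGet ''D_len'' (ivar ''j'') (INum 0)) + 1 + k * (1 + 180 * k) \<le> 200 * k\<^sup>2"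
    using k_pos k_le_square by linarith
qed (use s rows card_colset[OF j] in \<open>simp_all add: input_simps\<close>)

lemma run_overlap:
  assumes s: "inputs s"
    and W: "sparse_rows ''W'' ''W'' ''W_mark'' ''W_len'' s W overlap"
    and rows: "sparse_rows ''U'' ''U'' ''U_mark'' ''U_len'' s (\<lambda>_ _. 0) (\<lambda>_. {})"
  shows "sparse_rows ''U'' ''U'' ''U_mark'' ''U_len'' (run overlap_com s) U uset \<and>
    cost overlap_com s \<le> 10 + n * (1 + 200 * k\<^sup>2)"
proof -
  let ?V = "\<lambda>x y. 0 + (\<Sum>j<n. \<Sum>r\<in>colset j. \<Sum>h\<in>overlap r. if x = j \<and> y = h then D $$ (r, j) * W r h else 0)"
  let ?S = "\<lambda>x. {} \<union> (\<Union>j<n. \<Union>r\<in>colset j. \<Union>h\<in>overlap r. if x = j then {h} else {})"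
  have "sparse_rows ''U'' ''U'' ''U_mark'' ''U_len'' (run overlap_com s) ?V ?S \<and>
    cost overlap_com s \<le> 10 + n * (1 + 200 * k\<^sup>2)"
    unfolding overlap_com_def
  proof (rule run_For_accum[where T = "\<lambda>_. 200 * k\<^sup>2"])
    fix j t V S
    assume t: "j < n" "unchanged (insert ''j'' (iwrites overlap_col)) (rwrites overlap_col) s t"
      "sparse_rows ''U'' ''U'' ''U_mark'' ''U_len'' t V S"
    have "inputs t"
      using s(1) by (intro inputs_unchanged[OF _ t(2)]) (simp_all add: input_simps)
    moreover have "sparse_rows ''W'' ''W'' ''W_mark'' ''W_len'' t W overlap"
      by (rule sparse_rows_unchanged[OF W t(2)]) simp_all
    ultimately show "sparse_rows ''U'' ''U'' ''U_mark'' ''U_len'' (run overlap_col (iset ''j'' 0 0 j t))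
        (\<lambda>x y. V x y + (\<Sum>r\<in>colset j. \<Sum>h\<in>overlap r. if x = j \<and> y = h then D $$ (r, j) * W r h else 0))
        (\<lambda>x. S x \<union> (\<Union>r\<in>colset j. \<Union>h\<in>overlap r. if x = j then {h} else {})) \<and>
      cost overlap_col (iset ''j'' 0 0 j t) \<le> 200 * k\<^sup>2"
      using t by (intro run_overlap_col) (simp_all add: input_simps)
  qed (use s rows in \<open>simp_all add: input_simps\<close>)
  moreover have "?S = uset"
    by (auto simp: uset_def colset_def fun_eq_iff split: if_splits)
  moreover have "?V = U"
  proof (intro ext)
    fix x y
    \<comment> \<open>Outside the list of row \<open>r\<close> the entry of \<open>W\<close> is
      zero, so summing over the list alone loses nothing.\<close>
    have "(\<Sum>h\<in>overlap r. if x = j \<and> y = h then D $$ (r, j) * W r h else 0)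
      = (if x = j then D $$ (r, j) * W r y else 0)" for r j
      using W_eq_0[of y r] by auto
    moreover have "(\<Sum>j<n. \<Sum>r\<in>colset j. if x = j then D $$ (r, j) * W r y else 0) =
      (\<Sum>j<n. if x = j then \<Sum>r\<in>colset j. D $$ (r, j) * W r y else 0)"
      by (intro sum.cong) auto
    ultimately show "?V x y = U x y"
      by (simp add: U_def colset_def)
  qed
  ultimately show ?thesis
    by metis
qed

subsection \<open>Running the iteration\<close>

lemma sum_entry: "j < p \<Longrightarrow> (\<Sum>r | j \<in> rowset r. entry r j * f r) = (\<Sum>r<m. entry r j * f r)"
  by (intro sum.mono_neutral_left) (auto simp: rowset_def entry_def)

lemma card_column: "j < p \<Longrightarrow> card {r. j \<in> rowset r} = clen j"
  using bij_betw_same_card[OF C_storage(1)] by simp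

lemma run_init_col:
  assumes s: "inputs s" "imem s ''j'' 0 0 = j" and j: "j < p"
  shows "rmem (run init_col s) ''v'' =
      (\<lambda>a b. rmem s ''v'' a b + (\<Sum>r | j \<in> rowset r. if a = j \<and> b = 0 then entry r j * x0 $ r else 0)) \<and>
    cost init_col s \<le> 6 + clen j * 40"
  unfolding init_col_def
proof (rule run_For_radd_list[OF _ C_storage(1)[OF j], where w = "clen j"])
  fix l t
  assume l: "l < clen j" "cidx j l \<in> {r. j \<in> rowset r}" and t: "unchanged {''l''} {''v''} s t"
  have "inputs t"
    using s(1) by (intro inputs_unchanged[OF _ t]) (simp_all add: input_simps)
  moreover have "imem t ''j'' = imem s ''j''"
    using t by (simp add: unchanged_def)
  moreover have "cidx j l < m"
    using l(2) by (simp add: rowset_def)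
  ultimately show "ival (ivar ''j'') (iset ''l'' 0 0 l t) = j \<and>
    rval (RMul (RGet ''C_val'' (ivar ''j'') (ivar ''l''))
         (RGet ''x0'' (IGet ''C_idx'' (ivar ''j'') (ivar ''l'')) (INum 0))) (iset ''l'' 0 0 l t) =
      entry (cidx j l) j * x0 $ cidx j l"
    using s C_storage(2)[OF j l(1)] by (simp add: input_simps)
qed (use s j in \<open>simp_all add: input_simps card_column\<close>)

lemma run_init:
  assumes s: "inputs s" and v: "rmem s ''v'' = (\<lambda>_ _. 0)"
  shows "(\<forall>j<p. rmem (run init_com s) ''v'' j 0 = (\<Sum>r<m. entry r j * x0 $ r)) \<and>
    cost init_com s \<le> 50 * (1 + p + m * k)"
proof -
  have "rmem (run init_com s) ''v'' = (\<lambda>a b. rmem s ''v'' a b +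
      (\<Sum>j<p. \<Sum>r | j \<in> rowset r. if a = j \<and> b = 0 then entry r j * x0 $ r else 0)) \<and>
    cost init_com s \<le> 50 * (1 + p + m * k)"
    unfolding init_com_def
  proof (rule run_For_add[where T = "\<lambda>j. 6 + clen j * 40"])
    fix j t
    assume t: "unchanged (insert ''j'' (iwrites init_col)) (rwrites init_col) s t" and j: "j < p"
    have "inputs t"
      using s(1) by (intro inputs_unchanged[OF _ t]) (simp_all add: input_simps)
    then show "rmem (run init_col (iset ''j'' 0 0 j t)) ''v'' = (\<lambda>a b. rmem t ''v'' a b +
        (\<Sum>r | j \<in> rowset r. if a = j \<and> b = 0 then entry r j * x0 $ r else 0)) \<and>
      cost init_col (iset ''j'' 0 0 j t) \<le> 6 + clen j * 40"
      using run_init_col[of "iset ''j'' 0 0 j t" j] j by (simp add: input_simps)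
  next
    show "icost (ivar ''p'') + 1 + (\<Sum>j<p. 1 + (6 + clen j * 40)) \<le> 50 * (1 + p + m * k)"
      using sum_clen by (simp add: sum.distrib flip: sum_distrib_right)
  qed (use s in \<open>simp_all add: input_simps\<close>)
  moreover have "(\<Sum>j<p. \<Sum>r | j \<in> rowset r. if a = j \<and> (0::nat) = 0 then entry r j * x0 $ r else 0) =
      (\<Sum>r<m. entry r a * x0 $ r)" if "a < p" for a
  proof -
    have "(\<Sum>j<p. \<Sum>r | j \<in> rowset r. if a = j \<and> (0::nat) = 0 then entry r j * x0 $ r else 0) =
      (\<Sum>j<p. if a = j then \<Sum>r | j \<in> rowset r. entry r j * x0 $ r else 0)"
      by (intro sum.cong) auto
    then show ?thesis
      using that sum_entry[OF that] by simp
  qed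
  ultimately show ?thesis
    by (simp add: v)
qed

text \<open>Adding \<open>x0\<close> acts as a copy because the array \<open>x\<close> is still
  zero.\<close>

lemma run_copy:
  assumes s: "inputs s" and "rmem s ''x'' = (\<lambda>_ _. 0)"
  shows "(\<forall>r<m. rmem (run copy_com s) ''x'' r 0 = x0 $ r) \<and> cost copy_com s \<le> 30 * (1 + m)"
proof -
  have "rmem (run copy_com s) ''x'' = (\<lambda>a b. rmem s ''x'' a b +
      (\<Sum>r<m. if a = r \<and> b = 0 then x0 $ r else 0)) \<and> cost copy_com s \<le> 30 * (1 + m)"
    unfolding copy_com_def
  proof (rule run_For_radd_list[where e = "\<lambda>r. r" and w = m])
    fix r t
    assume r: "r < m" and t: "unchanged {''r''} {''x''} s t"
    have "inputs t"
      using s(1) by (intro inputs_unchanged[OF _ t]) (simp_all add: input_simps)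
    then show "ival (ivar ''r'') (iset ''r'' 0 0 r t) = r \<and>
      rval (RGet ''x0'' (ivar ''r'') (INum 0)) (iset ''r'' 0 0 r t) = x0 $ r"
      using r by (simp add: input_simps)
  qed (use s in \<open>simp_all add: input_simps bij_betw_def\<close>)
  then show ?thesis
    using assms(2) by simp
qed

lemma run_result_col:
  assumes s: "inputs s" "imem s ''j'' 0 0 = j" "rmem s ''z'' j 0 = z" and j: "j < p"
  shows "rmem (run result_col s) ''x'' = (\<lambda>a b. rmem s ''x'' a b +
      (\<Sum>r | j \<in> rowset r. if a = r \<and> b = 0 then entry r j * z else 0)) \<and>
    cost result_col s \<le> 6 + clen j * 40"
  unfolding result_col_def
proof (rule run_For_radd_list[OF _ C_storage(1)[OF j], where w = "clen j"])
  fix l t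
  assume l: "l < clen j" and t: "unchanged {''l''} {''x''} s t"
  have "inputs t"
    using s(1) by (intro inputs_unchanged[OF _ t]) (simp_all add: input_simps)
  moreover have "imem t ''j'' = imem s ''j''" "rmem t ''z'' = rmem s ''z''"
    using t by (simp_all add: unchanged_def)
  ultimately show "ival (IGet ''C_idx'' (ivar ''j'') (ivar ''l'')) (iset ''l'' 0 0 l t) = cidx j l \<and>
    rval (RMul (RGet ''C_val'' (ivar ''j'') (ivar ''l'')) (RGet ''z'' (ivar ''j'') (INum 0)))
      (iset ''l'' 0 0 l t) = entry (cidx j l) j * z"
    using s C_storage(2)[OF j l(1)] by (simp add: input_simps)
qed (use s j in \<open>simp_all add: input_simps card_column\<close>)

lemma run_result:
  assumes s: "inputs s"
  shows "(\<forall>r<m. rmem (run result_com s) ''x'' r 0 =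
      rmem s ''x'' r 0 + (\<Sum>j<p. entry r j * rmem s ''z'' j 0)) \<and>
    cost result_com s \<le> 50 * (1 + p + m * k)"
proof -
  have "rmem (run result_com s) ''x'' = (\<lambda>a b. rmem s ''x'' a b +
      (\<Sum>j<p. \<Sum>r | j \<in> rowset r. if a = r \<and> b = 0 then entry r j * rmem s ''z'' j 0 else 0)) \<and>
    cost result_com s \<le> 50 * (1 + p + m * k)"
    unfolding result_com_def
  proof (rule run_For_add[where T = "\<lambda>j. 6 + clen j * 40"])
    fix j t
    assume t: "unchanged (insert ''j'' (iwrites result_col)) (rwrites result_col) s t" and j: "j < p"
    have "inputs t"
      using s(1) by (intro inputs_unchanged[OF _ t]) (simp_all add: input_simps)
    moreover have "rmem t ''z'' = rmem s ''z''"
      using t by (simp add: unchanged_def)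
    ultimately show "rmem (run result_col (iset ''j'' 0 0 j t)) ''x'' = (\<lambda>a b. rmem t ''x'' a b +
        (\<Sum>r | j \<in> rowset r. if a = r \<and> b = 0 then entry r j * rmem s ''z'' j 0 else 0)) \<and>
      cost result_col (iset ''j'' 0 0 j t) \<le> 6 + clen j * 40"
      using run_result_col[of "iset ''j'' 0 0 j t" j "rmem s ''z'' j 0"] j by (simp add: input_simps)
  next
    show "icost (ivar ''p'') + 1 + (\<Sum>j<p. 1 + (6 + clen j * 40)) \<le> 50 * (1 + p + m * k)"
      using sum_clen by (simp add: sum.distrib flip: sum_distrib_right)
  qed (use s in \<open>simp_all add: input_simps\<close>)
  moreover have "(\<Sum>r | j \<in> rowset r. if a = r \<and> (0::nat) = 0 then entry r j * z else 0) = entry a j * z"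
    for a j z
  proof -
    have "finite {r. j \<in> rowset r}"
      by (rule finite_subset[of _ "{..<m}"]) (auto simp: rowset_def)
    then show ?thesis
      by (simp add: entry_def)
  qed
  ultimately show ?thesis
    by simp
qed

section \<open>The loops of a single iteration\<close>

lemma uset_less: "h \<in> uset j \<Longrightarrow> h < p"
  by (auto simp: uset_def overlap_def rowset_def)

lemma finite_uset [simp]: "finite (uset j)"
  by (simp add: uset_def)

lemma U_eq_0: "h \<notin> uset j \<Longrightarrow> U j h = 0"
  by (auto simp: U_def uset_def W_eq_0)

lemma run_num_loop:
  assumes s: "inputs s" "imem s ''j'' 0 0 = j" and j: "j < n"
  shows "rmem (run num_loop s) ''b'' 0 0 =
      rmem s ''b'' 0 0 + (\<Sum>r\<in>colset j. D $$ (r, j) * rmem s ''v'' r 0) \<and>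
    cost num_loop s \<le> 60 * k"
proof -
  have "rmem (run num_loop s) ''b'' = (\<lambda>x y. rmem s ''b'' x y +
      (\<Sum>r\<in>colset j. if x = 0 \<and> y = 0 then D $$ (r, j) * rmem s ''v'' r 0 else 0)) \<and>
    cost num_loop s \<le> 60 * k"
    unfolding num_loop_def
  proof (rule run_For_radd_list[OF _ D_storage(1)[OF j], where w = k])
    fix l t
    assume l: "l < dlen j" and t: "unchanged {''l''} {''b''} s t"
    have "inputs t"
      using s(1) by (intro inputs_unchanged[OF _ t]) (simp_all add: input_simps)
    moreover have "imem t ''j'' = imem s ''j''" "rmem t ''v'' = rmem s ''v''"
      using t by (simp_all add: unchanged_def)
    ultimately show "ival (INum 0) (iset ''l'' 0 0 l t) = 0 \<and>
      rval (RMul (RGet ''D_val'' (ivar ''j'') (ivar ''l''))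
         (RGet ''v'' (IGet ''D_idx'' (ivar ''j'') (ivar ''l'')) (INum 0))) (iset ''l'' 0 0 l t) =
        D $$ (didx j l, j) * rmem s ''v'' (didx j l) 0"
      using s D_storage(2)[OF j l] by (simp add: input_simps)
  qed (use s k_pos card_colset[OF j] in \<open>simp_all add: input_simps\<close>)
  then show ?thesis
    by simp
qed

lemma run_den_loop:
  assumes s: "inputs s" "imem s ''j'' 0 0 = j" and j: "j < n" and U: "rmem s ''U'' = U"
  shows "rmem (run den_loop s) ''g'' 0 0 =
      rmem s ''g'' 0 0 + (\<Sum>r\<in>colset j. D $$ (r, j) * U j r) \<and>
    cost den_loop s \<le> 60 * k"
proof -
  have "rmem (run den_loop s) ''g'' = (\<lambda>x y. rmem s ''g'' x y +
      (\<Sum>r\<in>colset j. if x = 0 \<and> y = 0 then D $$ (r, j) * U j r else 0)) \<and>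
    cost den_loop s \<le> 60 * k"
    unfolding den_loop_def
  proof (rule run_For_radd_list[OF _ D_storage(1)[OF j], where w = k])
    fix l t
    assume l: "l < dlen j" and t: "unchanged {''l''} {''g''} s t"
    have "inputs t"
      using s(1) by (intro inputs_unchanged[OF _ t]) (simp_all add: input_simps)
    moreover have "imem t ''j'' = imem s ''j''" "rmem t ''U'' = U"
      using t U by (simp_all add: unchanged_def)
    ultimately show "ival (INum 0) (iset ''l'' 0 0 l t) = 0 \<and>
      rval (RMul (RGet ''D_val'' (ivar ''j'') (ivar ''l''))
         (RGet ''U'' (ivar ''j'') (IGet ''D_idx'' (ivar ''j'') (ivar ''l'')))) (iset ''l'' 0 0 l t) =
        D $$ (didx j l, j) * U j (didx j l)"
      using s D_storage(2)[OF j l] by (simp add: input_simps)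
  qed (use s k_pos card_colset[OF j] in \<open>simp_all add: input_simps\<close>)
  then show ?thesis
    by simp
qed

lemma run_num_loop':
  assumes s: "imem s ''j'' 0 0 = j" and j: "j < n"
    and U: "sparse_rows ''U'' ''U'' ''U_mark'' ''U_len'' s U uset"
  shows "rmem (run num_loop' s) ''b'' 0 0 =
      rmem s ''b'' 0 0 + (\<Sum>h\<in>uset j. rmem s ''z'' h 0 * U j h) \<and>
    cost num_loop' s \<le> 60 * k"
proof -
  have U': "bij_betw (imem s ''U'' j) {..<imem s ''U_len'' j 0} (uset j)" "rmem s ''U'' = U"
    using U by (simp_all add: sparse_rows_def)
  have "rmem (run num_loop' s) ''b'' = (\<lambda>x y. rmem s ''b'' x y +
      (\<Sum>h\<in>uset j. if x = 0 \<and> y = 0 then rmem s ''z'' h 0 * U j h else 0)) \<and>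
    cost num_loop' s \<le> 60 * k"
    unfolding num_loop'_def
  proof (rule run_For_radd_list[OF _ U'(1), where w = k])
    fix a t
    assume t: "unchanged {''a''} {''b''} s t"
    then have "imem t ''j'' = imem s ''j''" "imem t ''U'' = imem s ''U''" "rmem t ''U'' = U"
      "rmem t ''z'' = rmem s ''z''"
      using U' by (simp_all add: unchanged_def)
    then show "ival (INum 0) (iset ''a'' 0 0 a t) = 0 \<and>
      rval (RMul (RGet ''z'' (IGet ''U'' (ivar ''j'') (ivar ''a'')) (INum 0))
         (RGet ''U'' (ivar ''j'') (IGet ''U'' (ivar ''j'') (ivar ''a'')))) (iset ''a'' 0 0 a t) =
        rmem s ''z'' (imem s ''U'' j a) 0 * U j (imem s ''U'' j a)"
      using s by simp
  qed (use s k_pos card_uset[OF j] in simp_all)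
  then show ?thesis
    by simp
qed

lemma run_z_loop:
  assumes s: "inputs s" "imem s ''j'' 0 0 = j" and j: "j < n"
  shows "rmem (run z_loop s) ''z'' h 0 = rmem s ''z'' h 0 +
      (if h \<in> colset j then rmem s ''c'' 0 0 * D $$ (h, j) else 0) \<and>
    cost z_loop s \<le> 60 * k"
proof -
  have "rmem (run z_loop s) ''z'' = (\<lambda>x y. rmem s ''z'' x y +
      (\<Sum>r\<in>colset j. if x = r \<and> y = 0 then rmem s ''c'' 0 0 * D $$ (r, j) else 0)) \<and>
    cost z_loop s \<le> 60 * k"
    unfolding z_loop_def
  proof (rule run_For_radd_list[OF _ D_storage(1)[OF j], where w = k])
    fix l t
    assume l: "l < dlen j" and t: "unchanged {''l''} {''z''} s t"
    have "inputs t"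
      using s(1) by (intro inputs_unchanged[OF _ t]) (simp_all add: input_simps)
    moreover have "imem t ''j'' = imem s ''j''" "rmem t ''c'' = rmem s ''c''"
      using t by (simp_all add: unchanged_def)
    ultimately show "ival (IGet ''D_idx'' (ivar ''j'') (ivar ''l'')) (iset ''l'' 0 0 l t) = didx j l \<and>
      rval (RMul (rvar ''c'') (RGet ''D_val'' (ivar ''j'') (ivar ''l''))) (iset ''l'' 0 0 l t) =
        rmem s ''c'' 0 0 * D $$ (didx j l, j)"
      using s D_storage(2)[OF j l] by (simp add: input_simps)
  qed (use s k_pos card_colset[OF j] in \<open>simp_all add: input_simps\<close>)
  then show ?thesis
    by simp
qed

text \<open>By \<open>U_eq_0\<close>, updating the listed positions amounts to subtracting or adding
  a multiple of the full vector \<open>u\<^sub>j\<close>, hence there is no case distinction on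
  \<open>h\<close>.\<close>

lemma run_v_loop:
  assumes s: "imem s ''j'' 0 0 = j" and j: "j < n"
    and U: "sparse_rows ''U'' ''U'' ''U_mark'' ''U_len'' s U uset"
  shows "rmem (run v_loop s) ''v'' h 0 = rmem s ''v'' h 0 + rmem s ''c'' 0 0 * U j h \<and>
    cost v_loop s \<le> 60 * k"
proof -
  have U': "bij_betw (imem s ''U'' j) {..<imem s ''U_len'' j 0} (uset j)" "rmem s ''U'' = U"
    using U by (simp_all add: sparse_rows_def)
  have "rmem (run v_loop s) ''v'' = (\<lambda>x y. rmem s ''v'' x y +
      (\<Sum>h\<in>uset j. if x = h \<and> y = 0 then rmem s ''c'' 0 0 * U j h else 0)) \<and>
    cost v_loop s \<le> 60 * k"
    unfolding v_loop_def
  proof (rule run_For_radd_list[OF _ U'(1), where w = k])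
    fix a t
    assume t: "unchanged {''a''} {''v''} s t"
    then have "imem t ''j'' = imem s ''j''" "imem t ''U'' = imem s ''U''" "rmem t ''U'' = U"
      "rmem t ''c'' = rmem s ''c''"
      using U' by (simp_all add: unchanged_def)
    then show "ival (IGet ''U'' (ivar ''j'') (ivar ''a'')) (iset ''a'' 0 0 a t) = imem s ''U'' j a \<and>
      rval (RMul (rvar ''c'') (RGet ''U'' (ivar ''j'') (IGet ''U'' (ivar ''j'') (ivar ''a''))))
        (iset ''a'' 0 0 a t) = rmem s ''c'' 0 0 * U j (imem s ''U'' j a)"
      using s by simp
  qed (use s k_pos card_uset[OF j] in simp_all)
  then show ?thesis
    using U_eq_0[of h j] by simp
qed

text \<open>Here \<open>c\<close> is only the quotient that the program computes from the old
  \<open>v\<close> and \<open>z\<close>. That it is the step length of the iteration follows later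
  from \<open>inner_col_Q\<close> and \<open>inner_col_Q_self\<close>.\<close>

lemma run_iterate_step:
  assumes s: "inputs s" "imem s ''t'' 0 0 = t" and t: "t < N"
    and U: "sparse_rows ''U'' ''U'' ''U_mark'' ''U_len'' s U uset"
  defines "j \<equiv> i t"
  defines "c \<equiv> ((\<Sum>r\<in>colset j. D $$ (r, j) * rmem s ''v'' r 0) + (\<Sum>h\<in>uset j. rmem s ''z'' h 0 * U j h)) /
    ((\<Sum>r\<in>colset j. D $$ (r, j) * U j r) + (\<Sum>r\<in>colset j. D $$ (r, j) * U j r))"
  shows "rmem (run iterate_step s) ''y'' h 0 = rmem s ''y'' h 0 - (if h = j then c else 0)"
    and "rmem (run iterate_step s) ''z'' h 0 = rmem s ''z'' h 0 - (if h \<in> colset j then c * D $$ (h, j) else 0)"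
    and "rmem (run iterate_step s) ''v'' h 0 = rmem s ''v'' h 0 - c * U j h"
    and "cost iterate_step s \<le> 500 * k"
proof -
  have j: "j < n" "imem s0 ''i'' t 0 = j"
    using q(1)[OF t] t by (simp_all add: j_def)
  let ?c1 = "Seq (ISet ''j'' (INum 0) (INum 0) (IGet ''i'' (ivar ''t'') (INum 0)))
       (Seq (RSet ''b'' (INum 0) (INum 0) (RNum 0)) (RSet ''g'' (INum 0) (INum 0) (RNum 0)))"
  let ?c5 = "Seq (RSet ''c'' (INum 0) (INum 0)
         (RSub (RNum 0) (RDiv (rvar ''b'') (RAdd (rvar ''g'') (rvar ''g'')))))
       (radd ''y'' (ivar ''j'') (INum 0) (rvar ''c''))"
  define s1 where "s1 = run ?c1 s"
  define s2 where "s2 = run num_loop s1"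
  define s3 where "s3 = run den_loop s2"
  define s4 where "s4 = run num_loop' s3"
  define s5 where "s5 = run ?c5 s4"
  define s6 where "s6 = run z_loop s5"
  define s7 where "s7 = run v_loop s6"
  \<comment> \<open>One frame argument for all intermediate memories: after the first segment, none
    of the remaining ones writes \<open>j\<close>, the input or the lists of
    \<open>U\<close>.\<close>
  have inv: "inputs u \<and> sparse_rows ''U'' ''U'' ''U_mark'' ''U_len'' u U uset \<and> imem u ''j'' 0 0 = j"
    if "unchanged {''l'', ''a''} {''b'', ''g'', ''c'', ''y'', ''z'', ''v''} s1 u" for u
  proof -
    have u: "unchanged {''j'', ''l'', ''a''} {''b'', ''g'', ''c'', ''y'', ''z'', ''v''} s u"
      using unchanged_run[of ?c1 s] that unfolding s1_def by (rule unchanged_trans) simp_all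
    have "imem s1 ''j'' 0 0 = j"
      using s j by (simp add: s1_def input_simps)
    then have "imem u ''j'' 0 0 = j"
      using that by (simp add: unchanged_def)
    moreover have "inputs u"
      by (rule inputs_unchanged[OF s(1) u]) (simp_all add: input_simps)
    moreover have "sparse_rows ''U'' ''U'' ''U_mark'' ''U_len'' u U uset"
      by (rule sparse_rows_unchanged[OF U u]) simp_all
    ultimately show ?thesis by simp
  qed
  have step: "iterate_step = Seq ?c1 (Seq num_loop (Seq den_loop (Seq num_loop' (Seq ?c5 (Seq z_loop v_loop)))))"
    by (simp add: iterate_step_def)
  have run: "run iterate_step s = s7"
    unfolding step s7_def s6_def s5_def s4_def s3_def s2_def s1_def by (simp only: run.simps(4))
  have cost: "cost iterate_step s = cost ?c1 s + (cost num_loop s1 + (cost den_loop s2 +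
      (cost num_loop' s3 + (cost ?c5 s4 + (cost z_loop s5 + cost v_loop s6)))))"
    unfolding step s6_def s5_def s4_def s3_def s2_def s1_def by (simp only: run.simps(4) cost.simps(4))
  have u: "unchanged {''l''} {''b''} s1 s2" "unchanged {''l''} {''g''} s2 s3" "unchanged {''a''} {''b''} s3 s4"
    "unchanged {} {''y'', ''c''} s4 s5" "unchanged {''l''} {''z''} s5 s6" "unchanged {''a''} {''v''} s6 s7"
    using unchanged_run[of num_loop s1] unchanged_run[of den_loop s2] unchanged_run[of num_loop' s3]
      unchanged_run[of ?c5 s4, folded s5_def] unchanged_run[of z_loop s5] unchanged_run[of v_loop s6]
    by (simp_all flip: s7_def s6_def s5_def s4_def s3_def s2_def)
  have u1: "unchanged {''l'', ''a''} {''b'', ''g'', ''c'', ''y'', ''z'', ''v''} s1 s1"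
    by simp
  have u2: "unchanged {''l'', ''a''} {''b'', ''g'', ''c'', ''y'', ''z'', ''v''} s1 s2"
    by (rule unchanged_trans[OF u1 u(1)]) simp_all
  have u3: "unchanged {''l'', ''a''} {''b'', ''g'', ''c'', ''y'', ''z'', ''v''} s1 s3"
    by (rule unchanged_trans[OF u2 u(2)]) simp_all
  have u4: "unchanged {''l'', ''a''} {''b'', ''g'', ''c'', ''y'', ''z'', ''v''} s1 s4"
    by (rule unchanged_trans[OF u3 u(3)]) simp_all
  have u5: "unchanged {''l'', ''a''} {''b'', ''g'', ''c'', ''y'', ''z'', ''v''} s1 s5"
    by (rule unchanged_trans[OF u4 u(4)]) simp_all
  have u6: "unchanged {''l'', ''a''} {''b'', ''g'', ''c'', ''y'', ''z'', ''v''} s1 s6"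
    by (rule unchanged_trans[OF u5 u(5)]) simp_all
  note inv = inv[OF u1] inv[OF u2] inv[OF u3] inv[OF u4] inv[OF u5] inv[OF u6]
  have U2: "rmem s2 ''U'' = U"
    using inv by (simp add: sparse_rows_def)
  have 1: "rmem s1 ''b'' 0 0 = 0" "rmem s1 ''g'' 0 0 = 0" "rmem s1 ''y'' = rmem s ''y''"
    "rmem s1 ''z'' = rmem s ''z''" "rmem s1 ''v'' = rmem s ''v''"
    by (simp_all add: s1_def)
  have 2: "rmem s2 ''b'' 0 0 = (\<Sum>r\<in>colset j. D $$ (r, j) * rmem s ''v'' r 0)" "cost num_loop s1 \<le> 60 * k"
    using run_num_loop[of s1 j] inv j(1) 1 by (simp_all add: s2_def)
  have 3: "rmem s3 ''g'' 0 0 = (\<Sum>r\<in>colset j. D $$ (r, j) * U j r)" "cost den_loop s2 \<le> 60 * k"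
    using run_den_loop[of s2 j] inv j(1) 1 u(1) U2 by (simp_all add: s3_def unchanged_def)
  have 4: "rmem s4 ''b'' 0 0 = (\<Sum>r\<in>colset j. D $$ (r, j) * rmem s ''v'' r 0) +
      (\<Sum>h\<in>uset j. rmem s ''z'' h 0 * U j h)" "cost num_loop' s3 \<le> 60 * k"
    using run_num_loop'[of s3 j] inv j(1) 1 2 u(1,2) by (simp_all add: s4_def unchanged_def)
  have 5: "rmem s5 ''c'' 0 0 = - c" "rmem s5 ''y'' h 0 = rmem s ''y'' h 0 - (if h = j then c else 0)"
    for h
    using 3 4 inv u(1,2,3) 1 by (simp_all add: s5_def c_def radd_def unchanged_def)
  have 6: "rmem s6 ''z'' h 0 = rmem s ''z'' h 0 - (if h \<in> colset j then c * D $$ (h, j) else 0)"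
    "cost z_loop s5 \<le> 60 * k" for h
    using run_z_loop[of s5 j h] inv j(1) 1 5 u(1-4) by (simp_all add: s6_def unchanged_def)
  have 7: "rmem s7 ''v'' h 0 = rmem s ''v'' h 0 - c * U j h" "cost v_loop s6 \<le> 60 * k" for h
    using run_v_loop[of s6 j h] inv j(1) 1 5 u(1-5) by (simp_all add: s7_def unchanged_def)
  show "rmem (run iterate_step s) ''y'' h 0 = rmem s ''y'' h 0 - (if h = j then c else 0)"
    using 5 u(5,6) by (simp add: run unchanged_def)
  show "rmem (run iterate_step s) ''z'' h 0 = rmem s ''z'' h 0 - (if h \<in> colset j then c * D $$ (h, j) else 0)"
    using 6 u(6) by (simp add: run unchanged_def)
  show "rmem (run iterate_step s) ''v'' h 0 = rmem s ''v'' h 0 - c * U j h"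
    using 7 by (simp add: run)
  \<comment> \<open>Five loops of at most \<open>60 * k\<close> each and two blocks of at most 50;
    the latter are absorbed by \<open>1 \<le> k\<close>.\<close>
  have "cost ?c1 s \<le> 50" "cost ?c5 s4 \<le> 50"
    by (simp_all add: radd_def)
  then show "cost iterate_step s \<le> 500 * k"
    using 2 3 4 6 7 k_pos unfolding cost by linarith
qed

section \<open>Inner products with the columns of \<open>Q\<close> in terms of
  \<open>W\<close>\<close>

lemma gram_eq: "(\<Sum>r<m. entry r a * entry r h) = W a h + W h a"
  unfolding W_def sum.distrib[symmetric] by (intro sum.cong) (auto simp: gram_term_def)

text \<open>In matrix form, \<open>(C u) \<bullet> (C w) = w \<bullet> (W\<^sup>T u) + u \<bullet>
  (W\<^sup>T w)\<close>, by \<open>gram_eq\<close> and exchanges of summation.\<close>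

lemma bilinear_gram:
  "(\<Sum>r<m. (\<Sum>h<p. entry r h * u h) * (\<Sum>a<p. entry r a * w a)) =
    (\<Sum>a<p. w a * (\<Sum>h<p. u h * W h a)) + (\<Sum>h<p. u h * (\<Sum>a<p. w a * W a h))"
proof -
  have "(\<Sum>r<m. (\<Sum>h<p. entry r h * u h) * (\<Sum>a<p. entry r a * w a)) =
      (\<Sum>r<m. \<Sum>h<p. \<Sum>a<p. u h * w a * (entry r a * entry r h))"
    by (simp add: sum_product mult_ac)
  also have "\<dots> = (\<Sum>h<p. \<Sum>r<m. \<Sum>a<p. u h * w a * (entry r a * entry r h))"
    by (rule sum.swap)
  also have "\<dots> = (\<Sum>h<p. \<Sum>a<p. \<Sum>r<m. u h * w a * (entry r a * entry r h))"
    by (intro sum.cong refl sum.swap)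
  also have "\<dots> = (\<Sum>h<p. \<Sum>a<p. u h * w a * (W a h + W h a))"
    by (simp add: gram_eq flip: sum_distrib_left)
  also have "\<dots> = (\<Sum>h<p. \<Sum>a<p. u h * w a * W h a) + (\<Sum>h<p. \<Sum>a<p. u h * w a * W a h)"
    by (simp add: algebra_simps sum.distrib)
  also have "(\<Sum>h<p. \<Sum>a<p. u h * w a * W h a) = (\<Sum>a<p. \<Sum>h<p. u h * w a * W h a)"
    by (rule sum.swap)
  finally show ?thesis
    by (simp add: sum_distrib_left mult_ac)
qed

lemma col_Q: "j < n \<Longrightarrow> r < m \<Longrightarrow> col Q j $ r = (\<Sum>h<p. entry r h * D $$ (h, j))"
proof -
  assume jr: "j < n" "r < m"
  have "Q = C * D"
    using sparse by (simp add: sparse_factorization_def)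
  then have "col Q j $ r = (\<Sum>h\<in>{0..<p}. C $$ (r, h) * D $$ (h, j))"
    using jr by (simp add: scalar_prod_def)
  also have "\<dots> = (\<Sum>h<p. entry r h * D $$ (h, j))"
    using jr by (intro sum.cong) (auto simp: entry_def rowset_def)
  finally show ?thesis .
qed

lemma sum_colset: "j < n \<Longrightarrow> (\<Sum>h\<in>colset j. D $$ (h, j) * f h) = (\<Sum>h<p. D $$ (h, j) * f h)"
  by (intro sum.mono_neutral_left) (auto simp: colset_def)

lemma sum_uset: "(\<Sum>h\<in>uset j. f h * U j h) = (\<Sum>h<p. f h * U j h)"
  by (intro sum.mono_neutral_left) (auto simp: uset_less U_eq_0)

lemma U_eq: "j < n \<Longrightarrow> U j h = (\<Sum>a<p. D $$ (a, j) * W a h)"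
  by (simp add: U_def sum_colset)

text \<open>Expanding \<open>(w + C z) \<bullet> (C d\<^sub>j)\<close>, the first part is
  \<open>d\<^sub>j \<bullet> (C\<^sup>T w)\<close> and the second is split by
  \<open>bilinear_gram\<close>; the terms with factor \<open>d\<^sub>j\<close> combine to
  \<open>v \<bullet> d\<^sub>j\<close>. The vector \<open>w\<close> is left general to allow both
  \<open>x0\<close> and zero.\<close>

lemma inner_col_Q:
  assumes j: "j < n" and v: "\<And>a. a < p \<Longrightarrow> v a = (\<Sum>r<m. entry r a * w r) + (\<Sum>h<p. z h * W h a)"
  shows "vec m (\<lambda>r. w r + (\<Sum>h<p. entry r h * z h)) \<bullet> col Q j =
    (\<Sum>a\<in>colset j. D $$ (a, j) * v a) + (\<Sum>h\<in>uset j. z h * U j h)"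
proof -
  let ?d = "\<lambda>a. D $$ (a, j)"
  have "vec m (\<lambda>r. w r + (\<Sum>h<p. entry r h * z h)) \<bullet> col Q j =
      (\<Sum>r<m. (w r + (\<Sum>h<p. entry r h * z h)) * (\<Sum>a<p. entry r a * ?d a))"
    using j by (simp add: scalar_prod_def col_Q atLeast0LessThan del: index_col)
  also have "\<dots> = (\<Sum>r<m. w r * (\<Sum>a<p. entry r a * ?d a)) +
      ((\<Sum>a<p. ?d a * (\<Sum>h<p. z h * W h a)) + (\<Sum>h<p. z h * U j h))"
    unfolding U_eq[OF j] bilinear_gram[symmetric] by (simp add: distrib_right sum.distrib)
  also have "(\<Sum>r<m. w r * (\<Sum>a<p. entry r a * ?d a)) = (\<Sum>r<m. \<Sum>a<p. ?d a * (entry r a * w r))"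
    by (simp add: sum_distrib_left mult_ac)
  also have "\<dots> = (\<Sum>a<p. \<Sum>r<m. ?d a * (entry r a * w r))"
    by (rule sum.swap)
  also have "\<dots> + ((\<Sum>a<p. ?d a * (\<Sum>h<p. z h * W h a)) + (\<Sum>h<p. z h * U j h)) =
      (\<Sum>a<p. ?d a * v a) + (\<Sum>h<p. z h * U j h)"
    by (simp add: v distrib_left sum.distrib flip: sum_distrib_left)
  finally show ?thesis
    by (simp add: sum_colset[OF j] sum_uset)
qed

text \<open>Instance of \<open>inner_col_Q\<close> with \<open>w = 0\<close> and
  \<open>z = d\<^sub>j\<close>, for which
  \<open>v = W\<^sup>T d\<^sub>j = u\<^sub>j\<close>.\<close>

lemma inner_col_Q_self:
  assumes j: "j < n"
  shows "col Q j \<bullet> col Q j =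
    (\<Sum>r\<in>colset j. D $$ (r, j) * U j r) + (\<Sum>r\<in>colset j. D $$ (r, j) * U j r)"
proof -
  let ?d = "\<lambda>a. D $$ (a, j)"
  have "col Q j = vec m (\<lambda>r. 0 + (\<Sum>h<p. entry r h * ?d h))"
    by (rule eq_vecI) (use j col_Q in \<open>simp_all del: index_col\<close>)
  then have "col Q j \<bullet> col Q j = (\<Sum>a\<in>colset j. ?d a * (\<Sum>h<p. ?d h * W h a)) + (\<Sum>h\<in>uset j. ?d h * U j h)"
    using inner_col_Q[OF j, of "\<lambda>a. \<Sum>h<p. ?d h * W h a" "\<lambda>_. 0" ?d] by simp
  then show ?thesis
    by (simp add: U_eq[OF j, symmetric] sum_uset sum_colset[OF j])
qed

section \<open>The invariant of the iteration\<close>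

definition iterate_inv :: "nat \<Rightarrow> memory \<Rightarrow> bool" where
  "iterate_inv t s \<longleftrightarrow>
     (\<forall>h<p. rmem s ''z'' h 0 = (\<Sum>j<n. D $$ (h, j) * rmem s ''y'' j 0)) \<and>
     (\<forall>a<p. rmem s ''v'' a 0 = (\<Sum>r<m. entry r a * x0 $ r) + (\<Sum>h<p. rmem s ''z'' h 0 * W h a)) \<and>
     iterate q x0 t = vec m (\<lambda>r. x0 $ r + (\<Sum>h<p. entry r h * rmem s ''z'' h 0))"

lemma iterate_inv_cong:
  "rmem s ''z'' = rmem s' ''z'' \<Longrightarrow> rmem s ''y'' = rmem s' ''y'' \<Longrightarrow> rmem s ''v'' = rmem s' ''v'' \<Longrightarrow>
    iterate_inv t s = iterate_inv t s'"
  by (simp add: iterate_inv_def)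

text \<open>Everything is linear: subtracting \<open>c\<close> from \<open>y\<^sub>j\<close>
  subtracts \<open>c d\<^sub>j\<close> from \<open>D y\<close>, which subtracts
  \<open>c u\<^sub>j\<close> from \<open>W\<^sup>T z\<close> and \<open>c q\<^sub>j\<close> from
  \<open>C z\<close>.\<close>

lemma iterate_inv_step:
  assumes s: "inputs s" "imem s ''t'' 0 0 = t" and t: "t < N"
    and U: "sparse_rows ''U'' ''U'' ''U_mark'' ''U_len'' s U uset"
    and inv: "iterate_inv t s"
  shows "iterate_inv (Suc t) (run iterate_step s)"
proof -
  define j where "j = i t"
  have j: "j < n" and qt: "q t = col Q j"
    using q[OF t] by (simp_all add: j_def)
  define y z v where "y h = rmem s ''y'' h 0" and "z h = rmem s ''z'' h 0" and "v h = rmem s ''v'' h 0" for h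
  define c where "c = ((\<Sum>r\<in>colset j. D $$ (r, j) * v r) + (\<Sum>h\<in>uset j. z h * U j h)) /
    ((\<Sum>r\<in>colset j. D $$ (r, j) * U j r) + (\<Sum>r\<in>colset j. D $$ (r, j) * U j r))"
  have z: "z h = (\<Sum>j<n. D $$ (h, j) * y j)" if "h < p" for h
    using inv that by (simp add: iterate_inv_def z_def y_def)
  have v: "v a = (\<Sum>r<m. entry r a * x0 $ r) + (\<Sum>h<p. z h * W h a)" if "a < p" for a
    using inv that by (simp add: iterate_inv_def z_def v_def)
  have it: "iterate q x0 t = vec m (\<lambda>r. x0 $ r + (\<Sum>h<p. entry r h * z h))"
    using inv by (simp add: iterate_inv_def z_def)
  \<comment> \<open>The computed quotient is the step length, by the formulas for the two inner
    products.\<close>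
  have c: "c = (iterate q x0 t \<bullet> q t) / (q t \<bullet> q t)"
    using inner_col_Q[OF j v] inner_col_Q_self[OF j] by (simp add: c_def it qt)
  note step = run_iterate_step[OF s t U, folded j_def y_def z_def v_def, folded c_def]
  have z': "rmem (run iterate_step s) ''z'' h 0 = z h - c * D $$ (h, j)" if "h < p" for h
    using step(2)[of h] that j by (auto simp: colset_def)
  have "z h - c * D $$ (h, j) = (\<Sum>j'<n. D $$ (h, j') * (y j' - (if j' = j then c else 0)))"
    if "h < p" for h
  proof -
    have "(\<Sum>j'<n. D $$ (h, j') * (y j' - (if j' = j then c else 0))) =
        (\<Sum>j'<n. D $$ (h, j') * y j') - (\<Sum>j'<n. if j' = j then D $$ (h, j') * c else 0)"
      unfolding sum_subtractf[symmetric] by (intro sum.cong) (auto simp: algebra_simps)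
    then show ?thesis
      using that j by (simp add: z mult.commute)
  qed
  moreover have "v a - c * U j a = (\<Sum>r<m. entry r a * x0 $ r) + (\<Sum>h<p. (z h - c * D $$ (h, j)) * W h a)"
    if "a < p" for a
    using that by (simp add: v U_eq[OF j] algebra_simps sum_subtractf sum_distrib_left)
  moreover have "iterate q x0 (Suc t) = vec m (\<lambda>r. x0 $ r + (\<Sum>h<p. entry r h * (z h - c * D $$ (h, j))))"
  proof -
    have "iterate q x0 (Suc t) = iterate q x0 t - c \<cdot>\<^sub>v col Q j"
      by (simp add: c flip: qt)
    also have "\<dots> = vec m (\<lambda>r. x0 $ r + (\<Sum>h<p. entry r h * (z h - c * D $$ (h, j))))"
      by (rule eq_vecI)
        (use j in \<open>simp_all add: it col_Q algebra_simps sum_subtractf sum_distrib_left del: index_col\<close>)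
    finally show ?thesis .
  qed
  ultimately show ?thesis
    unfolding iterate_inv_def by (simp add: step(1,3) z' del: iterate.simps)
qed

lemma run_iterate:
  assumes s: "inputs s" and U: "sparse_rows ''U'' ''U'' ''U_mark'' ''U_len'' s U uset"
    and zero: "rmem s ''y'' = (\<lambda>_ _. 0)" "rmem s ''z'' = (\<lambda>_ _. 0)"
    and v: "\<forall>j<p. rmem s ''v'' j 0 = (\<Sum>r<m. entry r j * x0 $ r)"
  shows "iterate_inv N (run iterate_com s) \<and> cost iterate_com s \<le> 4 + N * (1 + 500 * k)"
  unfolding iterate_com_def
proof (rule run_For[where I = iterate_inv and T = "\<lambda>_. 500 * k"])
  have "x0 = vec m (\<lambda>r. x0 $ r)"
    by (rule eq_vecI) simp_all
  then show "iterate_inv 0 s"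
    using zero v by (simp add: iterate_inv_def)
next
  fix l t
  assume l: "l < N" and t: "unchanged (insert ''t'' (iwrites iterate_step)) (rwrites iterate_step) s t"
    and inv: "iterate_inv l t"
  have "inputs t"
    by (rule inputs_unchanged[OF s t]) (simp_all add: input_simps)
  moreover have "sparse_rows ''U'' ''U'' ''U_mark'' ''U_len'' t U uset"
    by (rule sparse_rows_unchanged[OF U t]) simp_all
  moreover have "iterate_inv l (iset ''t'' 0 0 l t)"
    using inv by (subst iterate_inv_cong) simp_all
  ultimately show "iterate_inv (Suc l) (run iterate_step (iset ''t'' 0 0 l t)) \<and>
      cost iterate_step (iset ''t'' 0 0 l t) \<le> 500 * k"
    using l by (intro conjI iterate_inv_step run_iterate_step(4)) (simp_all add: input_simps)
qed (use s in \<open>simp_all add: input_simps\<close>)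

section \<open>The whole program and its cost\<close>

lemma run_main:
  assumes "0 < m"
  shows "stored_vec (run main_com s0) ''x'' m = iterate q x0 N"
    and "iterate q x0 N = x0 + Q *\<^sub>v stored_vec (run main_com s0) ''y'' n"
    and "cost main_com s0 \<le> 2000 * (N * k + (m + n) * k\<^sup>2)"
proof -
  define s1 where "s1 = run transpose_com s0"
  define s2 where "s2 = run gram_com s1"
  define s3 where "s3 = run overlap_com s2"
  define s4 where "s4 = run init_com s3"
  define s5 where "s5 = run iterate_com s4"
  define s6 where "s6 = run copy_com s5"
  define s7 where "s7 = run result_com s6"
  have run: "run main_com s0 = s7"
    unfolding main_com_def s7_def s6_def s5_def s4_def s3_def s2_def s1_def by (simp only: run.simps(4))
  have cost: "cost main_com s0 = cost transpose_com s0 + (cost gram_com s1 + (cost overlap_com s2 +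
      (cost init_com s3 + (cost iterate_com s4 + (cost copy_com s5 + cost result_com s6)))))"
    unfolding main_com_def s6_def s5_def s4_def s3_def s2_def s1_def
    by (simp only: run.simps(4) cost.simps(4))
  note u = unchanged_run[of transpose_com s0, folded s1_def] unchanged_run[of gram_com s1, folded s2_def]
    unchanged_run[of overlap_com s2, folded s3_def] unchanged_run[of init_com s3, folded s4_def]
    unchanged_run[of iterate_com s4, folded s5_def] unchanged_run[of copy_com s5, folded s6_def]
    unchanged_run[of result_com s6, folded s7_def]
  have i0: "inputs s0"
    by (simp add: inputs_def)
  have i1: "inputs s1" by (rule inputs_unchanged[OF i0 u(1)]) (simp_all add: input_simps)
  have i2: "inputs s2" by (rule inputs_unchanged[OF i1 u(2)]) (simp_all add: input_simps)
  have i3: "inputs s3" by (rule inputs_unchanged[OF i2 u(3)]) (simp_all add: input_simps)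
  have i4: "inputs s4" by (rule inputs_unchanged[OF i3 u(4)]) (simp_all add: input_simps)
  have i5: "inputs s5" by (rule inputs_unchanged[OF i4 u(5)]) (simp_all add: input_simps)
  have i6: "inputs s6" by (rule inputs_unchanged[OF i5 u(6)]) (simp_all add: input_simps)
  \<comment> \<open>Zero memory represents the zero matrix with empty row lists; this initializes
    \<open>R\<close>, \<open>W\<close> and \<open>U\<close>.\<close>
  have empty: "sparse_rows A L M B s0 (\<lambda>_ _. 0) (\<lambda>_. {})"
    if "A \<notin> input_rnames" "L \<notin> input_inames" "M \<notin> input_inames" "B \<notin> input_inames" for A L M B
    using input_values(9,10) that by (simp add: sparse_rows_def bij_betw_def)
  have zero: "rmem s0 a = (\<lambda>_ _. 0)" if "a \<notin> input_rnames" for a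
    using input_values(10) that by blast
  have R: "sparse_rows ''R'' ''R'' ''R_mark'' ''R_len'' s1 entry rowset"
      "cost transpose_com s0 \<le> 200 * (1 + p + m * k)"
    using run_transpose[OF i0 empty] by (simp_all add: input_simps s1_def)
  have "sparse_rows ''W'' ''W'' ''W_mark'' ''W_len'' s1 (\<lambda>_ _. 0) (\<lambda>_. {})"
    by (rule sparse_rows_unchanged[OF empty u(1)]) (simp_all add: input_simps)
  then have W: "sparse_rows ''W'' ''W'' ''W_mark'' ''W_len'' s2 W overlap"
      "cost gram_com s1 \<le> 10 + m * (1 + 170 * k\<^sup>2)"
    using run_gram[OF i1 R(1)] by (simp_all add: s2_def)
  have u02: "unchanged (iwrites transpose_com \<union> iwrites gram_com) (rwrites transpose_com \<union> rwrites gram_com) s0 s2"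
    by (rule unchanged_trans[OF u(1,2)]) simp_all
  have "sparse_rows ''U'' ''U'' ''U_mark'' ''U_len'' s2 (\<lambda>_ _. 0) (\<lambda>_. {})"
    by (rule sparse_rows_unchanged[OF empty u02]) (simp_all add: input_simps)
  then have U: "sparse_rows ''U'' ''U'' ''U_mark'' ''U_len'' s3 U uset"
      "cost overlap_com s2 \<le> 10 + n * (1 + 200 * k\<^sup>2)"
    using run_overlap[OF i2 W(1)] by (simp_all add: s3_def)
  have s3: "rmem s3 ''v'' = (\<lambda>_ _. 0)" "rmem s3 ''x'' = (\<lambda>_ _. 0)"
      "rmem s3 ''y'' = (\<lambda>_ _. 0)" "rmem s3 ''z'' = (\<lambda>_ _. 0)"
    using u(1-3) by (simp_all add: unchanged_def zero input_rnames_def)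
  have v: "\<forall>j<p. rmem s4 ''v'' j 0 = (\<Sum>r<m. entry r j * x0 $ r)"
      "cost init_com s3 \<le> 50 * (1 + p + m * k)"
    using run_init[OF i3] s3 by (simp_all add: s4_def)
  have "sparse_rows ''U'' ''U'' ''U_mark'' ''U_len'' s4 U uset"
    by (rule sparse_rows_unchanged[OF U(1) u(4)]) simp_all
  moreover have s4: "rmem s4 ''x'' = (\<lambda>_ _. 0)" "rmem s4 ''y'' = (\<lambda>_ _. 0)" "rmem s4 ''z'' = (\<lambda>_ _. 0)"
    using s3 u(4) by (simp_all add: unchanged_def)
  ultimately have inv: "iterate_inv N s5" "cost iterate_com s4 \<le> 4 + N * (1 + 500 * k)"
    using run_iterate[OF i4] v(1) by (simp_all add: s5_def)
  have "rmem s5 ''x'' = (\<lambda>_ _. 0)"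
    using s4 u(5) by (simp add: unchanged_def)
  then have x: "\<forall>r<m. rmem s6 ''x'' r 0 = x0 $ r" "cost copy_com s5 \<le> 30 * (1 + m)"
    using run_copy[OF i5] by (simp_all add: s6_def)
  have z: "rmem s6 ''z'' = rmem s5 ''z''" "rmem s7 ''y'' = rmem s5 ''y''"
    using u(6,7) by (simp_all add: unchanged_def)
  have x': "\<forall>r<m. rmem s7 ''x'' r 0 = x0 $ r + (\<Sum>j<p. entry r j * rmem s5 ''z'' j 0)"
      "cost result_com s6 \<le> 50 * (1 + p + m * k)"
    using run_result[OF i6] x(1) z by (simp_all add: s7_def)
  have it: "iterate q x0 N = vec m (\<lambda>r. x0 $ r + (\<Sum>h<p. entry r h * rmem s5 ''z'' h 0))"
    using inv(1) by (simp add: iterate_inv_def)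
  show "stored_vec (run main_com s0) ''x'' m = iterate q x0 N"
    using x'(1) by (auto simp: run it stored_vec_def)
  \<comment> \<open>This is \<open>Q y = C (D y) = C z\<close>; the last step is the first clause of
    the invariant.\<close>
  have Qy: "(Q *\<^sub>v stored_vec s7 ''y'' n) $ r = (\<Sum>h<p. entry r h * rmem s5 ''z'' h 0)" if r: "r < m" for r
  proof -
    have "(Q *\<^sub>v stored_vec s7 ''y'' n) $ r = (\<Sum>j<n. col Q j $ r * rmem s5 ''y'' j 0)"
      using r by (simp add: stored_vec_def scalar_prod_def z atLeast0LessThan)
    also have "\<dots> = (\<Sum>j<n. \<Sum>h<p. entry r h * (D $$ (h, j) * rmem s5 ''y'' j 0))"
      using r by (simp add: col_Q sum_distrib_right mult.assoc del: index_col)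
    also have "\<dots> = (\<Sum>h<p. \<Sum>j<n. entry r h * (D $$ (h, j) * rmem s5 ''y'' j 0))"
      by (rule sum.swap)
    also have "\<dots> = (\<Sum>h<p. entry r h * rmem s5 ''z'' h 0)"
      using inv(1) by (simp add: iterate_inv_def flip: sum_distrib_left)
    finally show ?thesis .
  qed
  show "iterate q x0 N = x0 + Q *\<^sub>v stored_vec (run main_com s0) ''y'' n"
    by (rule eq_vecI) (use Qy in \<open>simp_all add: run it\<close>)
  \<comment> \<open>With these names the estimate becomes linear. The additive constants, 354 in
    all, are absorbed by \<open>1 \<le> a\<close>, where \<open>0 < m\<close> enters. The
    coefficients of \<open>a\<close>, \<open>b\<close> and \<open>c\<close> are then at most 855,
    501 and 501.\<close>
  define a b c where "a = m * k\<^sup>2" and "b = n * k\<^sup>2" and "c = N * k"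
  have "k \<le> k\<^sup>2" "1 \<le> k"
    using k_le_square k_pos by simp_all
  then have "p \<le> b" "m * k \<le> a" "n \<le> b" "m \<le> a" "N \<le> c" "1 \<le> a"
    using p_le assms mult_le_mono2[of k "k\<^sup>2" n] by (auto simp: a_def b_def c_def intro: order.trans)
  moreover have "N * (1 + 500 * k) = N + 500 * c" "m * (1 + 170 * k\<^sup>2) = m + 170 * a"
    "n * (1 + 200 * k\<^sup>2) = n + 200 * b" "N * k + (m + n) * k\<^sup>2 = c + (a + b)"
    by (simp_all add: a_def b_def c_def algebra_simps)
  ultimately show "cost main_com s0 \<le> 2000 * (N * k + (m + n) * k\<^sup>2)"
    using R(2) W(2) U(2) v(2) inv(2) x(2) x'(2) unfolding cost by simp
qed

end

text \<open>The same program and constant serve both assertions, since one run of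
  \<open>main_com\<close> leaves the iterate in \<open>x\<close> and the coefficients in
  \<open>y\<close>.\<close>

theorem theorem3p3:
  shows
    "(\<exists>(P :: com) (K :: nat). \<forall>(m :: nat) (n :: nat) (p :: nat) (k :: nat) (N :: nat)
        (Q :: real mat) (C :: real mat) (D :: real mat) (x0 :: real vec)
        (q :: nat \<Rightarrow> real vec) (i :: nat \<Rightarrow> nat) (s :: memory).
        0 < m \<longrightarrow> 0 < n \<longrightarrow> 0 < k \<longrightarrow>
        Q \<in> carrier_mat m n \<longrightarrow> C \<in> carrier_mat m p \<longrightarrow> D \<in> carrier_mat p n \<longrightarrow>
        sparse_factorization k Q C D \<longrightarrow>
        x0 \<in> carrier_vec m \<longrightarrow>
        (\<forall>t<N. i t < n \<and> q t = col Q (i t) \<and> q t \<noteq> 0\<^sub>v m) \<longrightarrow>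
        initial_memory s C D x0 N i \<longrightarrow>
          cost P s \<le> K * (N * k + (m + n) * k ^ 2) \<and>
          stored_vec (run P s) ''x'' m = iterate q x0 N)
     \<and>
     (\<exists>(P :: com) (K :: nat). \<forall>(m :: nat) (n :: nat) (p :: nat) (k :: nat) (N :: nat)
        (Q :: real mat) (C :: real mat) (D :: real mat) (x0 :: real vec)
        (q :: nat \<Rightarrow> real vec) (i :: nat \<Rightarrow> nat) (s :: memory).
        0 < m \<longrightarrow> 0 < n \<longrightarrow> 0 < k \<longrightarrow>
        Q \<in> carrier_mat m n \<longrightarrow> C \<in> carrier_mat m p \<longrightarrow> D \<in> carrier_mat p n \<longrightarrow>
        sparse_factorization k Q C D \<longrightarrow>
        x0 \<in> carrier_vec m \<longrightarrow>
        (\<forall>t<N. i t < n \<and> q t = col Q (i t) \<and> q t \<noteq> 0\<^sub>v m) \<longrightarrow>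
        initial_memory s C D x0 N i \<longrightarrow>
          cost P s \<le> K * (N * k + (m + n) * k ^ 2) \<and>
          iterate q x0 N = x0 + Q *\<^sub>v stored_vec (run P s) ''y'' n)"
proof (intro conjI exI[of _ main_com] exI[of _ "2000 :: nat"] allI impI)
  fix m n p k N :: nat and Q C D :: "real mat" and x0 :: "real vec"
    and q :: "nat \<Rightarrow> real vec" and i :: "nat \<Rightarrow> nat" and s :: memory
  assume asm: "0 < m" "0 < k" "Q \<in> carrier_mat m n" "C \<in> carrier_mat m p" "D \<in> carrier_mat p n"
    "sparse_factorization k Q C D" "x0 \<in> carrier_vec m"
    "\<forall>t<N. i t < n \<and> q t = col Q (i t) \<and> q t \<noteq> 0\<^sub>v m" "initial_memory s C D x0 N i"
  then interpret sparse_input m n p k N Q C D x0 q i s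
    by unfold_locales auto
  show "cost main_com s \<le> 2000 * (N * k + (m + n) * k ^ 2)"
    "stored_vec (run main_com s) ''x'' m = iterate q x0 N"
    "cost main_com s \<le> 2000 * (N * k + (m + n) * k ^ 2)"
    "iterate q x0 N = x0 + Q *\<^sub>v stored_vec (run main_com s) ''y'' n"
    using run_main asm(1) by blast+
qed

end
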